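(* Let $\Gamma_{\mathcal T}$ be an $\tilde A_2$-group and let $\Lambda_{\mathcal T}=\{w\in\Gamma_{\mathcal T}:\delta(w)\ge\mathbf 1\}$ be the associated $2$-graph. The cocycle $c:\Lambda_{\mathcal T}\to\Gamma_{\mathcal T}$, determined by $w=c(w)s(w)$ with $\delta(s(w))=\mathbf 1$ and $\delta(c(w))=\delta(w)-\mathbf 1$, is essential, and the canonical map $i:\Lambda_{\mathcal T}\to\Pi(\Lambda_{\mathcal T})$ is injective.
   Context: $\tilde A_2$-groups. A finite projective plane $(P,L)$ of order $q$ consists of finite sets $P$ (points), $L$ (lines), $|P|=|L|=q^2+q+1$, and an incidence relation $\in$ from $P$ to $L$ such that any two distinct points lie on exactly one common line, any two distinct lines contain exactly one common point, and there are four distinct points no three of which are on one line. Given a bijection $\lambda:P\to L$, a triella compatible with $\lambda$ is a set $\mathcal T\subset P\times P\times P$ such that: (T1) for $x,y\in P$ there exists $z\in P$ with $(x,y,z)\in\mathcal T$ iff $y\in\lambda(x)$; (T2) $(x,y,z)\in\mathcal T\Rightarrow(y,z,x)\in\mathcal T$; (T3) for $x,y\in P$ there is at most one $z\in P$ with $(x,y,z)\in\mathcal T$. The associated $\tilde A_2$-group is $\Gamma_{\mathcal T}=\langle a_x,\ x\in P\mid a_xa_ya_z=1\text{ for each }(x,y,z)\in\mathcal T\rangle$. Shape function. It is known that every $w\in\Gamma_{\mathcal T}$ can be written with unique $m,n\ge0$ and unique $x_i,y_j\in P$ as $w=a_{x_1}\cdots a_{x_m}a_{y_1}^{-1}\cdots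 a_{y_n}^{-1}$ where $x_{i+1}\notin\lambda(x_i)$ for $1\le i<m$, $y_j\notin\lambda(y_{j+1})$ for $1\le j<n$, and $x_m\ne y_1$ if $m,n\ge1$. Define $\delta(w)=(m,n)\in\mathbb{N}^2$. Write $\mathbf 1=(1,1)$; $\le$ on $\mathbb{N}^2$ is coordinatewise. Unique factorisation holds: if $\delta(w)=m+n$ with $m,n\in\mathbb{N}^2$ there are unique $h,k\in\Gamma_{\mathcal T}$ with $w=hk$, $\delta(h)=m$, $\delta(k)=n$. The $2$-graph $\Lambda_{\mathcal T}$: $\Lambda_{\mathcal T}=\{w\in\Gamma_{\mathcal T}:\delta(w)\ge\mathbf 1\}$, $\Lambda^0_{\mathcal T}=\{u:\delta(u)=\mathbf 1\}$, degree $d(w)=\delta(w)-\mathbf 1$; $r,s,b,c$ are given by the unique factorisations $w=r(w)b(w)=c(w)s(w)$ with $\delta(r(w))=\delta(s(w))=\mathbf 1$, $\delta(b(w))=\delta(c(w))=\delta(w)-\mathbf 1$; composition is $\lambda\circ\mu=c(\lambda)s(\lambda)b(\mu)$ when $s(\lambda)=r(\mu)$. This is a $2$-graph (a small category with a functor $d$ to $\mathbb{N}^2$ with unique factorisations $\lambda=\mu\circ\nu$, $d(\mu)=m$, $d(\nu)=n$ whenever $d(\lambda)=m+n$), and $c$ is a $1$-cocycle (functor to a group). A $1$-cocycle $c:\Lambda\to G$ is essential if its restriction to $u\Lambda v=\{\lambda:r(\lambda)=u,s(\lambda)=v\}$ is injective for all $u,v\in\Lambda^0$. The fundamental groupoid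 of a $2$-graph $\Lambda$ is a groupoid $\Pi(\Lambda)$ with a functor $i:\Lambda\to\Pi(\Lambda)$, $i(\Lambda^0)=\Pi(\Lambda)^0$, such that every functor $F$ from $\Lambda$ to a groupoid $\mathcal G$ is $\tilde F\circ i$ for a unique groupoid homomorphism $\tilde F:\Pi(\Lambda)\to\mathcal G$. *)

theory Defs
  imports
    "HOL-Algebra.Group"
    "HOL-Library.Product_Plus"
    "HOL-Library.Product_Order"
begin

section \<open>Groups given by generators and relations\<close>

text \<open>
  A word is a list of signed generators: the letter (x, True) stands for the generator x and
  (x, False) for its inverse.  The relation below is the smallest congruence on words over X
  that cancels inverse letters and kills every relator in R.
\<close>

inductive pres_eq :: "'x set \<Rightarrow> ('x \<times> bool) list set \<Rightarrow> ('x \<times> bool) list \<Rightarrow> ('x \<times> bool) list \<Rightarrow> bool"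
  for X :: "'x set" and R :: "('x \<times> bool) list set" where
  refl: "set w \<subseteq> X \<times> UNIV \<Longrightarrow> pres_eq X R w w"
| sym: "pres_eq X R v w \<Longrightarrow> pres_eq X R w v"
| trans: "pres_eq X R u v \<Longrightarrow> pres_eq X R v w \<Longrightarrow> pres_eq X R u w"
| append: "pres_eq X R u v \<Longrightarrow> pres_eq X R u' v' \<Longrightarrow> pres_eq X R (u @ u') (v @ v')"
| cancel: "x \<in> X \<Longrightarrow> pres_eq X R [(x, b), (x, \<not> b)] []"
| relator: "r \<in> R \<Longrightarrow> set r \<subseteq> X \<times> UNIV \<Longrightarrow> pres_eq X R r []"

definition pres_class :: "'x set \<Rightarrow> ('x \<times> bool) list set \<Rightarrow> ('x \<times> bool) list \<Rightarrow> ('x \<times> bool) list set" where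
  "pres_class X R w = {v. pres_eq X R w v}"

definition presented_group :: "'x set \<Rightarrow> ('x \<times> bool) list set \<Rightarrow> ('x \<times> bool) list set monoid" where
  "presented_group X R =
     \<lparr> carrier = {pres_class X R w | w. set w \<subseteq> X \<times> UNIV},
       mult = (\<lambda>A B. {w. \<exists>u\<in>A. \<exists>v\<in>B. pres_eq X R (u @ v) w}),
       one = pres_class X R [] \<rparr>"

lemma pres_eq_words:
  "pres_eq X R u v \<Longrightarrow> set u \<subseteq> X \<times> UNIV \<and> set v \<subseteq> X \<times> UNIV"
  by (induction rule: pres_eq.induct) auto

lemma pres_class_eqI: "pres_eq X R u v \<Longrightarrow> pres_class X R u = pres_class X R v"
  unfolding pres_class_def by (blast intro: pres_eq.sym pres_eq.trans)

lemma presented_group_mult: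
  assumes u: "set u \<subseteq> X \<times> UNIV" and v: "set v \<subseteq> X \<times> UNIV"
  shows "pres_class X R u \<otimes>\<^bsub>presented_group X R\<^esub> pres_class X R v = pres_class X R (u @ v)"
proof -
  have "(\<exists>u'\<in>pres_class X R u. \<exists>v'\<in>pres_class X R v. pres_eq X R (u' @ v') w) \<longleftrightarrow> pres_eq X R (u @ v) w" for w
  proof
    assume "\<exists>u'\<in>pres_class X R u. \<exists>v'\<in>pres_class X R v. pres_eq X R (u' @ v') w"
    then obtain u' v' where "pres_eq X R u u'" "pres_eq X R v v'" "pres_eq X R (u' @ v') w"
      unfolding pres_class_def by blast
    then show "pres_eq X R (u @ v) w" using pres_eq.append pres_eq.trans by blast
  next
    assume "pres_eq X R (u @ v) w"
    moreover have "u \<in> pres_class X R u" "v \<in> pres_class X R v"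
      using u v by (simp_all add: pres_class_def pres_eq.refl)
    ultimately show "\<exists>u'\<in>pres_class X R u. \<exists>v'\<in>pres_class X R v. pres_eq X R (u' @ v') w" by blast
  qed
  then show ?thesis by (simp add: presented_group_def pres_class_def)
qed

lemma pres_eq_inverse:
  "set w \<subseteq> X \<times> UNIV \<Longrightarrow> pres_eq X R (rev (map (\<lambda>(x, b). (x, \<not> b)) w) @ w) []"
proof (induction w)
  case Nil
  then show ?case by (simp add: pres_eq.refl)
next
  case (Cons p w)
  obtain x b where p: "p = (x, b)" by (cases p)
  let ?i = "rev (map (\<lambda>(x, b). (x, \<not> b)) w)"
  have x: "x \<in> X" and w: "set w \<subseteq> X \<times> UNIV" using Cons.prems p by auto
  have i: "set ?i \<subseteq> X \<times> UNIV" using w by auto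
  have "pres_eq X R ([(x, \<not> b), (x, b)] @ w) ([] @ w)"
    using pres_eq.append[OF pres_eq.cancel[OF x, of R "\<not> b"] pres_eq.refl[OF w]] by simp
  then have "pres_eq X R (?i @ ([(x, \<not> b), (x, b)] @ w)) (?i @ ([] @ w))"
    using pres_eq.append[OF pres_eq.refl[OF i]] by blast
  then have "pres_eq X R (?i @ ([(x, \<not> b), (x, b)] @ w)) []"
    using pres_eq.trans[OF _ Cons.IH[OF w]] by simp
  then show ?case by (simp add: p)
qed

lemma group_presented_group: "group (presented_group X R)"
proof (rule groupI)
  let ?G = "presented_group X R"
  have car: "carrier ?G = {pres_class X R w | w. set w \<subseteq> X \<times> UNIV}"
    and one: "\<one>\<^bsub>?G\<^esub> = pres_class X R []"
    by (simp_all add: presented_group_def)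
  show "\<one>\<^bsub>?G\<^esub> \<in> carrier ?G" by (auto simp: car one)
  fix A assume "A \<in> carrier ?G"
  then obtain u where u: "A = pres_class X R u" "set u \<subseteq> X \<times> UNIV" by (auto simp: car)
  show "\<one>\<^bsub>?G\<^esub> \<otimes>\<^bsub>?G\<^esub> A = A"
    using u by (simp add: one presented_group_mult)
  show "\<exists>B\<in>carrier ?G. B \<otimes>\<^bsub>?G\<^esub> A = \<one>\<^bsub>?G\<^esub>"
  proof -
    let ?v = "rev (map (\<lambda>(x, b). (x, \<not> b)) u)"
    have v: "set ?v \<subseteq> X \<times> UNIV" using u by auto
    have "pres_class X R ?v \<otimes>\<^bsub>?G\<^esub> A = \<one>\<^bsub>?G\<^esub>"
      unfolding u(1) one presented_group_mult[OF v u(2)]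
      by (rule pres_class_eqI[OF pres_eq_inverse[OF u(2)]])
    then show ?thesis using v car by blast
  qed
  fix B assume "B \<in> carrier ?G"
  then obtain v where v: "B = pres_class X R v" "set v \<subseteq> X \<times> UNIV" by (auto simp: car)
  have "A \<otimes>\<^bsub>?G\<^esub> B = pres_class X R (u @ v)" using u v presented_group_mult by metis
  moreover have "set (u @ v) \<subseteq> X \<times> UNIV" using u v by simp
  ultimately show "A \<otimes>\<^bsub>?G\<^esub> B \<in> carrier ?G" unfolding car by blast
  fix C assume "C \<in> carrier ?G"
  then obtain w where w: "C = pres_class X R w" "set w \<subseteq> X \<times> UNIV" by (auto simp: car)
  show "A \<otimes>\<^bsub>?G\<^esub> B \<otimes>\<^bsub>?G\<^esub> C = A \<otimes>\<^bsub>?G\<^esub> (B \<otimes>\<^bsub>?G\<^esub> C)"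
    using u v w by (simp add: presented_group_mult)
qed

section \<open>Triellas and the associated groups\<close>

text \<open>Points and lines are sets with an arbitrary incidence relation \<open>I x l\<close> (the point x is on the line l).\<close>

definition finite_projective_plane ::
  "nat \<Rightarrow> 'p set \<Rightarrow> 'l set \<Rightarrow> ('p \<Rightarrow> 'l \<Rightarrow> bool) \<Rightarrow> bool" where
  "finite_projective_plane q P L I \<longleftrightarrow>
     finite P \<and> finite L \<and> card P = q\<^sup>2 + q + 1 \<and> card L = q\<^sup>2 + q + 1 \<and>
     (\<forall>x\<in>P. \<forall>y\<in>P. x \<noteq> y \<longrightarrow> (\<exists>!l. l \<in> L \<and> I x l \<and> I y l)) \<and>
     (\<forall>l\<in>L. \<forall>m\<in>L. l \<noteq> m \<longrightarrow> (\<exists>!x. x \<in> P \<and> I x l \<and> I x m)) \<and>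
     (\<exists>Q\<subseteq>P. card Q = 4 \<and>
        (\<forall>x\<in>Q. \<forall>y\<in>Q. \<forall>z\<in>Q. x \<noteq> y \<and> y \<noteq> z \<and> x \<noteq> z \<longrightarrow>
           \<not> (\<exists>l\<in>L. I x l \<and> I y l \<and> I z l)))"

definition triella ::
  "'p set \<Rightarrow> ('p \<Rightarrow> 'l \<Rightarrow> bool) \<Rightarrow> ('p \<Rightarrow> 'l) \<Rightarrow> ('p \<times> 'p \<times> 'p) set \<Rightarrow> bool" where
  "triella P I lam T \<longleftrightarrow>
     T \<subseteq> P \<times> P \<times> P \<and>
     (\<forall>x\<in>P. \<forall>y\<in>P. (\<exists>z\<in>P. (x, y, z) \<in> T) \<longleftrightarrow> I y (lam x)) \<and>
     (\<forall>x y z. (x, y, z) \<in> T \<longrightarrow> (y, z, x) \<in> T) \<and>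
     (\<forall>x\<in>P. \<forall>y\<in>P. \<forall>z\<in>P. \<forall>z'\<in>P. (x, y, z) \<in> T \<and> (x, y, z') \<in> T \<longrightarrow> z = z')"

definition triella_relators :: "('p \<times> 'p \<times> 'p) set \<Rightarrow> ('p \<times> bool) list set" where
  "triella_relators T = {[(x, True), (y, True), (z, True)] | x y z. (x, y, z) \<in> T}"

definition A2_group :: "'p set \<Rightarrow> ('p \<times> 'p \<times> 'p) set \<Rightarrow> ('p \<times> bool) list set monoid" where
  "A2_group P T = presented_group P (triella_relators T)"

definition A2_gen :: "'p set \<Rightarrow> ('p \<times> 'p \<times> 'p) set \<Rightarrow> 'p \<Rightarrow> ('p \<times> bool) list set" where
  "A2_gen P T x = pres_class P (triella_relators T) [(x, True)]"

section \<open>The shape function\<close>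

definition A2_normal :: "'p set \<Rightarrow> ('p \<Rightarrow> 'l \<Rightarrow> bool) \<Rightarrow> ('p \<Rightarrow> 'l) \<Rightarrow> 'p list \<Rightarrow> 'p list \<Rightarrow> bool" where
  "A2_normal P I lam xs ys \<longleftrightarrow>
     set xs \<subseteq> P \<and> set ys \<subseteq> P \<and>
     successively (\<lambda>x x'. \<not> I x' (lam x)) xs \<and>
     successively (\<lambda>y y'. \<not> I y (lam y')) ys \<and>
     (xs \<noteq> [] \<and> ys \<noteq> [] \<longrightarrow> last xs \<noteq> hd ys)"

definition A2_product ::
  "'p set \<Rightarrow> ('p \<times> 'p \<times> 'p) set \<Rightarrow> 'p list \<Rightarrow> 'p list \<Rightarrow> ('p \<times> bool) list set" where
  "A2_product P T xs ys =
     foldr (mult (A2_group P T))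
       (map (A2_gen P T) xs @ map (\<lambda>y. inv\<^bsub>A2_group P T\<^esub> (A2_gen P T y)) ys)
       \<one>\<^bsub>A2_group P T\<^esub>"

definition A2_shape ::
  "'p set \<Rightarrow> ('p \<Rightarrow> 'l \<Rightarrow> bool) \<Rightarrow> ('p \<Rightarrow> 'l) \<Rightarrow> ('p \<times> 'p \<times> 'p) set \<Rightarrow> ('p \<times> bool) list set \<Rightarrow> nat \<times> nat" where
  "A2_shape P I lam T w =
     (THE mn. \<exists>xs ys. A2_normal P I lam xs ys \<and> mn = (length xs, length ys) \<and>
        w = A2_product P T xs ys)"

section \<open>Small categories, 2-graphs and cocycles\<close>

text \<open>Small categories are presented by their arrows, objects being identified with their identity
  arrows.  An arrow a goes from \<open>src a\<close> to \<open>rng a\<close>, so \<open>cmp a b\<close> is meaningful when \<open>src a = rng b\<close>;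
  the operations are unconstrained off the arrows.\<close>

record 'a category =
  arrows :: "'a set"
  objects :: "'a set"
  rng :: "'a \<Rightarrow> 'a"
  src :: "'a \<Rightarrow> 'a"
  cmp :: "'a \<Rightarrow> 'a \<Rightarrow> 'a"

record 'a two_graph = "'a category" +
  degree :: "'a \<Rightarrow> nat \<times> nat"

definition small_category :: "('a, 'm) category_scheme \<Rightarrow> bool" where
  "small_category C \<longleftrightarrow>
     objects C \<subseteq> arrows C \<and>
     (\<forall>a\<in>arrows C. rng C a \<in> objects C \<and> src C a \<in> objects C) \<and>
     (\<forall>u\<in>objects C. rng C u = u \<and> src C u = u) \<and>
     (\<forall>a\<in>arrows C. \<forall>b\<in>arrows C. src C a = rng C b \<longrightarrow>
        cmp C a b \<in> arrows C \<and> rng C (cmp C a b) = rng C a \<and> src C (cmp C a b) = src C b) \<and>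
     (\<forall>a\<in>arrows C. cmp C (rng C a) a = a \<and> cmp C a (src C a) = a) \<and>
     (\<forall>a\<in>arrows C. \<forall>b\<in>arrows C. \<forall>c\<in>arrows C. src C a = rng C b \<and> src C b = rng C c \<longrightarrow>
        cmp C (cmp C a b) c = cmp C a (cmp C b c))"

definition groupoid :: "('a, 'm) category_scheme \<Rightarrow> bool" where
  "groupoid C \<longleftrightarrow> small_category C \<and>
     (\<forall>a\<in>arrows C. \<exists>b\<in>arrows C. rng C b = src C a \<and> src C b = rng C a \<and>
        cmp C a b = rng C a \<and> cmp C b a = src C a)"

definition is_functor :: "('a, 'm) category_scheme \<Rightarrow> ('b, 'n) category_scheme \<Rightarrow> ('a \<Rightarrow> 'b) \<Rightarrow> bool" where
  "is_functor C D F \<longleftrightarrow>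
     (\<forall>a\<in>arrows C. F a \<in> arrows D \<and> rng D (F a) = F (rng C a) \<and> src D (F a) = F (src C a)) \<and>
     (\<forall>u\<in>objects C. F u \<in> objects D) \<and>
     (\<forall>a\<in>arrows C. \<forall>b\<in>arrows C. src C a = rng C b \<longrightarrow> F (cmp C a b) = cmp D (F a) (F b))"

definition one_cocycle :: "('a, 'm) category_scheme \<Rightarrow> ('g, 'n) monoid_scheme \<Rightarrow> ('a \<Rightarrow> 'g) \<Rightarrow> bool" where
  "one_cocycle C G c \<longleftrightarrow>
     (\<forall>a\<in>arrows C. c a \<in> carrier G) \<and>
     (\<forall>u\<in>objects C. c u = \<one>\<^bsub>G\<^esub>) \<and>
     (\<forall>a\<in>arrows C. \<forall>b\<in>arrows C. src C a = rng C b \<longrightarrow> c (cmp C a b) = c a \<otimes>\<^bsub>G\<^esub> c b)"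

definition essential_cocycle :: "('a, 'm) category_scheme \<Rightarrow> ('g, 'n) monoid_scheme \<Rightarrow> ('a \<Rightarrow> 'g) \<Rightarrow> bool" where
  "essential_cocycle C G c \<longleftrightarrow>
     one_cocycle C G c \<and>
     (\<forall>u\<in>objects C. \<forall>v\<in>objects C. inj_on c {a \<in> arrows C. rng C a = u \<and> src C a = v})"

section \<open>The 2-graph of a triella\<close>

definition A2_factor ::
  "'p set \<Rightarrow> ('p \<Rightarrow> 'l \<Rightarrow> bool) \<Rightarrow> ('p \<Rightarrow> 'l) \<Rightarrow> ('p \<times> 'p \<times> 'p) set \<Rightarrow> nat \<times> nat \<Rightarrow> nat \<times> nat \<Rightarrow>
     ('p \<times> bool) list set \<Rightarrow> ('p \<times> bool) list set \<times> ('p \<times> bool) list set" where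
  "A2_factor P I lam T m n w =
     (THE hk. fst hk \<in> carrier (A2_group P T) \<and> snd hk \<in> carrier (A2_group P T) \<and>
        w = fst hk \<otimes>\<^bsub>A2_group P T\<^esub> snd hk \<and>
        A2_shape P I lam T (fst hk) = m \<and> A2_shape P I lam T (snd hk) = n)"

context
  fixes P :: "'p set" and I :: "'p \<Rightarrow> 'l \<Rightarrow> bool" and lam :: "'p \<Rightarrow> 'l" and T :: "('p \<times> 'p \<times> 'p) set"
begin

definition A2_r :: "('p \<times> bool) list set \<Rightarrow> ('p \<times> bool) list set" where
  "A2_r w = fst (A2_factor P I lam T (1, 1) (A2_shape P I lam T w - (1, 1)) w)"

definition A2_b :: "('p \<times> bool) list set \<Rightarrow> ('p \<times> bool) list set" where
  "A2_b w = snd (A2_factor P I lam T (1, 1) (A2_shape P I lam T w - (1, 1)) w)"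

definition A2_c :: "('p \<times> bool) list set \<Rightarrow> ('p \<times> bool) list set" where
  "A2_c w = fst (A2_factor P I lam T (A2_shape P I lam T w - (1, 1)) (1, 1) w)"

definition A2_s :: "('p \<times> bool) list set \<Rightarrow> ('p \<times> bool) list set" where
  "A2_s w = snd (A2_factor P I lam T (A2_shape P I lam T w - (1, 1)) (1, 1) w)"

definition A2_graph :: "('p \<times> bool) list set two_graph" where
  "A2_graph =
     \<lparr> arrows = {w \<in> carrier (A2_group P T). (1, 1) \<le> A2_shape P I lam T w},
       objects = {u \<in> carrier (A2_group P T). A2_shape P I lam T u = (1, 1)},
       rng = A2_r,
       src = A2_s,
       cmp = (\<lambda>v w. A2_c v \<otimes>\<^bsub>A2_group P T\<^esub> A2_s v \<otimes>\<^bsub>A2_group P T\<^esub> A2_b w),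
       degree = (\<lambda>w. A2_shape P I lam T w - (1, 1)) \<rparr>"

end

section \<open>The fundamental groupoid\<close>

text \<open>
  The universal property defining the fundamental groupoid quantifies over all groupoids, hence over
  all types, which HOL cannot express inside a formula.  We first state it for test groupoids
  whose arrows live in one type \<open>'u\<close>.  Uniqueness of the induced homomorphism H is as a map on the
  arrows of Q.
\<close>

definition fundamental_groupoid_wrt ::
  "'u itself \<Rightarrow> ('a, 'm) category_scheme \<Rightarrow> 'g category \<Rightarrow> ('a \<Rightarrow> 'g) \<Rightarrow> bool" where
  "fundamental_groupoid_wrt TYPE('u) C Q i \<longleftrightarrow>
     groupoid Q \<and> is_functor C Q i \<and> i ` objects C = objects Q \<and>
     (\<forall>(G :: 'u category) F. groupoid G \<and> is_functor C G F \<longrightarrow>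
        (\<exists>H. is_functor Q G H \<and> (\<forall>a\<in>arrows C. H (i a) = F a) \<and>
           (\<forall>H'. is_functor Q G H' \<and> (\<forall>a\<in>arrows C. H' (i a) = F a) \<longrightarrow>
              (\<forall>p\<in>arrows Q. H' p = H p))))"

text \<open>
  The type of test arrows chosen here is large enough to contain both Q itself and the groupoid of
  classes of signed paths in C.  Theorem \<open>fundamental_groupoid_universal\<close> below shows that the
  property then holds for test groupoids over every type, so nothing is lost by fixing this type;
  theorem \<open>fundamental_groupoid_exists\<close> shows that a fundamental groupoid exists.
\<close>

definition fundamental_groupoid ::
  "('a, 'm) category_scheme \<Rightarrow> 'g category \<Rightarrow> ('a \<Rightarrow> 'g) \<Rightarrow> bool" where
  "fundamental_groupoid C Q i \<longleftrightarrow>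
     fundamental_groupoid_wrt TYPE('g + ('a \<times> bool) list set) C Q i"


subsection \<open>The groupoid of signed paths\<close>

fun letter_rng :: "('a, 'm) category_scheme \<Rightarrow> 'a \<times> bool \<Rightarrow> 'a" where
  "letter_rng C (a, b) = (if b then rng C a else src C a)"

fun letter_src :: "('a, 'm) category_scheme \<Rightarrow> 'a \<times> bool \<Rightarrow> 'a" where
  "letter_src C (a, b) = (if b then src C a else rng C a)"

inductive path_eq :: "('a, 'm) category_scheme \<Rightarrow> ('a \<times> bool) list \<Rightarrow> ('a \<times> bool) list \<Rightarrow> bool"
  for C :: "('a, 'm) category_scheme" where
  letter: "a \<in> arrows C \<Longrightarrow> path_eq C [(a, b)] [(a, b)]"
| sym: "path_eq C v w \<Longrightarrow> path_eq C w v"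
| trans: "path_eq C u v \<Longrightarrow> path_eq C v w \<Longrightarrow> path_eq C u w"
| append: "path_eq C u v \<Longrightarrow> path_eq C u' v' \<Longrightarrow> letter_src C (last u) = letter_rng C (hd u') \<Longrightarrow>
    path_eq C (u @ u') (v @ v')"
| cmp: "a \<in> arrows C \<Longrightarrow> b \<in> arrows C \<Longrightarrow> src C a = rng C b \<Longrightarrow>
    path_eq C [(a, True), (b, True)] [(cmp C a b, True)]"
| inv: "a \<in> arrows C \<Longrightarrow> path_eq C [(a, b), (a, \<not> b)] [(letter_rng C (a, b), True)]"
| unit: "a \<in> arrows C \<Longrightarrow> path_eq C [(letter_rng C (a, b), True), (a, b)] [(a, b)]"
| unit': "a \<in> arrows C \<Longrightarrow> path_eq C [(a, b), (letter_src C (a, b), True)] [(a, b)]"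

abbreviation "is_path C w \<equiv> path_eq C w w"

definition path_class :: "('a, 'm) category_scheme \<Rightarrow> ('a \<times> bool) list \<Rightarrow> ('a \<times> bool) list set" where
  "path_class C w = {v. path_eq C w v}"

definition path_rep :: "'b set \<Rightarrow> 'b" where
  "path_rep A = (SOME w. w \<in> A)"

definition path_groupoid :: "('a, 'm) category_scheme \<Rightarrow> ('a \<times> bool) list set category" where
  "path_groupoid C =
     \<lparr> arrows = path_class C ` {w. is_path C w},
       objects = (\<lambda>u. path_class C [(u, True)]) ` objects C,
       rng = (\<lambda>A. path_class C [(letter_rng C (hd (path_rep A)), True)]),
       src = (\<lambda>A. path_class C [(letter_src C (last (path_rep A)), True)]),
       cmp = (\<lambda>A B. path_class C (path_rep A @ path_rep B)) \<rparr>"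

lemma path_eq_left: "path_eq C v w \<Longrightarrow> is_path C v"
  by (rule path_eq.trans[OF _ path_eq.sym])

lemma path_eq_right: "path_eq C v w \<Longrightarrow> is_path C w"
  by (rule path_eq.trans[OF path_eq.sym])

lemma path_class_eqI: "path_eq C v w \<Longrightarrow> path_class C v = path_class C w"
  unfolding path_class_def by (blast intro: path_eq.sym path_eq.trans)

lemma path_rep: "is_path C w \<Longrightarrow> path_eq C w (path_rep (path_class C w))"
  unfolding path_rep_def path_class_def mem_Collect_eq by (rule someI[of "path_eq C w"])

lemma path_class_eqD: "is_path C w \<Longrightarrow> path_class C v = path_class C w \<Longrightarrow> path_eq C v w"
  unfolding path_class_def by blast

context
  fixes C :: "('a, 'm) category_scheme"
  assumes C: "small_category C"
begin

lemma cat_obj: "u \<in> objects C \<Longrightarrow> u \<in> arrows C \<and> rng C u = u \<and> src C u = u"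
  using C unfolding small_category_def by blast

lemma cat_ends: "a \<in> arrows C \<Longrightarrow> rng C a \<in> objects C \<and> src C a \<in> objects C"
  using C unfolding small_category_def by blast

lemma cat_cmp: "a \<in> arrows C \<Longrightarrow> b \<in> arrows C \<Longrightarrow> src C a = rng C b \<Longrightarrow>
    cmp C a b \<in> arrows C \<and> rng C (cmp C a b) = rng C a \<and> src C (cmp C a b) = src C b"
  using C unfolding small_category_def by blast

lemma cat_unit: "a \<in> arrows C \<Longrightarrow> cmp C (rng C a) a = a \<and> cmp C a (src C a) = a"
  using C unfolding small_category_def by blast

lemma cat_assoc: "a \<in> arrows C \<Longrightarrow> b \<in> arrows C \<Longrightarrow> c \<in> arrows C \<Longrightarrow>
    src C a = rng C b \<Longrightarrow> src C b = rng C c \<Longrightarrow> cmp C (cmp C a b) c = cmp C a (cmp C b c)"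
  using C unfolding small_category_def by blast

lemma path_eq_ends:
  "path_eq C v w \<Longrightarrow> v \<noteq> [] \<and> w \<noteq> [] \<and> fst ` set v \<subseteq> arrows C \<and> fst ` set w \<subseteq> arrows C \<and>
     letter_rng C (hd v) = letter_rng C (hd w) \<and> letter_src C (last v) = letter_src C (last w)"
proof (induction rule: path_eq.induct)
  case (sym v w)
  then show ?case by metis
next
  case (trans u v w)
  then show ?case by metis
next
  case (append u v u' v')
  then show ?case by (simp add: image_Un)
next
  case (cmp a b)
  then show ?case using cat_cmp[of a b] by simp
next
  case (inv a b)
  then show ?case using cat_ends[of a] cat_obj[of "rng C a"] cat_obj[of "src C a"] by simp
next
  case (unit a b)
  then show ?case using cat_ends[of a] cat_obj[of "rng C a"] cat_obj[of "src C a"] by simp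
next
  case (unit' a b)
  then show ?case using cat_ends[of a] cat_obj[of "rng C a"] cat_obj[of "src C a"] by simp
qed simp

lemma path_ends_obj:
  assumes "is_path C w"
  shows "letter_rng C (hd w) \<in> objects C" "letter_src C (last w) \<in> objects C"
proof -
  have w: "w \<noteq> []" "fst ` set w \<subseteq> arrows C" using path_eq_ends[OF assms] by blast+
  have "letter_rng C x \<in> objects C \<and> letter_src C x \<in> objects C" if "x \<in> set w" for x
  proof -
    have "fst x \<in> arrows C" using w that by blast
    then show ?thesis using cat_ends by (cases x) simp
  qed
  then show "letter_rng C (hd w) \<in> objects C" "letter_src C (last w) \<in> objects C"
    using w by simp_all
qed

lemma is_path_split:
  "path_eq C v w \<Longrightarrow>
    (\<forall>x y ys. v = x # y # ys \<longrightarrow> is_path C (y # ys) \<and> letter_src C x = letter_rng C y) \<and>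
    (\<forall>x y ys. w = x # y # ys \<longrightarrow> is_path C (y # ys) \<and> letter_src C x = letter_rng C y)"
proof (induction rule: path_eq.induct)
  case (append u v u' v')
  have e: "u \<noteq> []" "v \<noteq> []" "u' \<noteq> []" "v' \<noteq> []"
    "letter_src C (last u) = letter_src C (last v)" "letter_rng C (hd u') = letter_rng C (hd v')"
    using path_eq_ends[OF append.hyps(1)] path_eq_ends[OF append.hyps(2)] by auto
  have *: "is_path C (y # ys) \<and> letter_src C x = letter_rng C y"
    if st: "s @ t = x # y # ys" "s \<noteq> []" "is_path C t" "letter_src C (last s) = letter_rng C (hd t)"
      and IH: "\<And>x y ys. s = x # y # ys \<Longrightarrow> is_path C (y # ys) \<and> letter_src C x = letter_rng C y"
    for s t x y ys
  proof (cases "tl s")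
    case Nil
    then have "s = [x]" "t = y # ys" using st(1,2) by (cases s; simp)+
    then show ?thesis using st(3,4) by simp
  next
    case (Cons z zs)
    then have s: "s = x # y # zs" "ys = zs @ t" using st(1,2) by (cases s; simp)+
    have p: "is_path C (y # zs)" "letter_src C x = letter_rng C y" using IH[OF s(1)] by blast+
    have "letter_src C (last (y # zs)) = letter_rng C (hd t)" using st(4) s(1) by simp
    then have "is_path C ((y # zs) @ t)" using path_eq.append[OF p(1) st(3)] by blast
    then show ?thesis using p(2) s(2) by simp
  qed
  have IHu: "is_path C (y # ys) \<and> letter_src C x = letter_rng C y" if "u = x # y # ys" for x y ys
    using append.IH(1) that by blast
  have IHv: "is_path C (y # ys) \<and> letter_src C x = letter_rng C y" if "v = x # y # ys" for x y ys
    using append.IH(1) that by blast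
  have j: "letter_src C (last v) = letter_rng C (hd v')" using append.hyps(3) e(5,6) by simp
  note u = *[OF _ e(1) path_eq_left[OF append.hyps(2)] append.hyps(3) IHu]
  note v = *[OF _ e(2) path_eq_right[OF append.hyps(2)] j IHv]
  show ?case using u v by blast
next
  case (sym v w)
  then show ?case by blast
next
  case (trans u v w)
  then show ?case by blast
qed (simp_all add: path_eq.letter cat_obj cat_ends)

lemma is_path_Cons:
  assumes "is_path C (x # y # ys)"
  shows "is_path C (y # ys)" "letter_src C x = letter_rng C y" "is_path C [x]"
proof -
  show "is_path C (y # ys)" "letter_src C x = letter_rng C y"
    using is_path_split[OF assms] by blast+
  have "fst x \<in> arrows C" using path_eq_ends[OF assms] by auto
  then show "is_path C [x]" by (cases x) (auto intro: path_eq.letter)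
qed

lemma is_path_append: "is_path C v \<Longrightarrow> is_path C w \<Longrightarrow> letter_src C (last v) = letter_rng C (hd w) \<Longrightarrow>
    is_path C (v @ w)"
  by (rule path_eq.append)

lemma is_path_unit: "u \<in> objects C \<Longrightarrow> is_path C [(u, True)]"
  by (simp add: cat_obj path_eq.letter)

lemma path_unit_left:
  assumes "is_path C w"
  shows "path_eq C ((letter_rng C (hd w), True) # w) w"
proof -
  obtain a b w' where w: "w = (a, b) # w'" using path_eq_ends[OF assms] by (cases w) auto
  have a: "a \<in> arrows C" using path_eq_ends[OF assms] w by auto
  show ?thesis
  proof (cases w')
    case Nil
    then show ?thesis using path_eq.unit[OF a, of b] w by simp
  next
    case (Cons y ys)
    have p: "is_path C w'" "letter_src C (a, b) = letter_rng C (hd w')"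
      using is_path_Cons[of "(a, b)" y ys] assms w Cons by auto
    show ?thesis using path_eq.append[OF path_eq.unit[OF a, of b] p(1)] p(2) w by simp
  qed
qed

lemma path_unit_right:
  assumes "is_path C w"
  shows "path_eq C (w @ [(letter_src C (last w), True)]) w"
  using assms
proof (induction w rule: list.induct)
  case Nil
  then show ?case using path_eq_ends by blast
next
  case (Cons x w)
  show ?case
  proof (cases w)
    case Nil
    obtain a b where x: "x = (a, b)" by (cases x)
    have "a \<in> arrows C" using path_eq_ends[OF Cons.prems] x by auto
    then show ?thesis using path_eq.unit'[of a C b] x Nil by simp
  next
    case (Cons y ys)
    have p: "is_path C w" "letter_src C x = letter_rng C (hd w)" "is_path C [x]"
      using is_path_Cons[of x y ys] \<open>is_path C (x # w)\<close> Cons by auto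
    have "path_eq C (w @ [(letter_src C (last w), True)]) w" using Cons.IH p by blast
    then have "path_eq C ([x] @ (w @ [(letter_src C (last w), True)])) ([x] @ w)"
      using path_eq.append[OF p(3)] p(2) Cons by simp
    then show ?thesis using Cons by simp
  qed
qed

lemma path_inverse:
  assumes "is_path C w"
  shows "\<exists>v. is_path C v \<and> letter_rng C (hd v) = letter_src C (last w) \<and>
     letter_src C (last v) = letter_rng C (hd w) \<and>
     path_eq C (w @ v) [(letter_rng C (hd w), True)] \<and>
     path_eq C (v @ w) [(letter_src C (last w), True)]"
  using assms
proof (induction w rule: list.induct)
  case Nil
  then show ?case using path_eq_ends by blast
next
  case (Cons x w)
  obtain a b where x: "x = (a, b)" by (cases x)
  have a: "a \<in> arrows C" using path_eq_ends[OF Cons.prems] x by auto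
  let ?x = "(a, \<not> b)"
  have lx: "is_path C [?x]" using a by (rule path_eq.letter)
  have 1: "path_eq C [x, ?x] [(letter_rng C x, True)]" using path_eq.inv[OF a, of b] x by simp
  have 2: "path_eq C [?x, x] [(letter_src C x, True)]" using path_eq.inv[OF a, of "\<not> b"] x by (cases b) simp_all
  have ex: "letter_rng C ?x = letter_src C x" "letter_src C ?x = letter_rng C x" using x by auto
  show ?case
  proof (cases w)
    case Nil
    then show ?thesis using 1 2 lx ex by (intro exI[of _ "[?x]"]) simp
  next
    case (Cons y ys)
    have p: "is_path C w" "letter_src C x = letter_rng C (hd w)" "is_path C [x]" "w \<noteq> []"
      using is_path_Cons[of x y ys] \<open>is_path C (x # w)\<close> Cons by auto
    obtain v where v: "is_path C v" "letter_rng C (hd v) = letter_src C (last w)"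
      "letter_src C (last v) = letter_rng C (hd w)"
      "path_eq C (w @ v) [(letter_rng C (hd w), True)]"
      "path_eq C (v @ w) [(letter_src C (last w), True)]"
      using Cons.IH p by blast
    have vn: "v \<noteq> []" using path_eq_ends[OF v(1)] by blast
    have vx: "is_path C (v @ [?x])" using is_path_append[OF v(1) lx] v p ex by simp
    have w1: "path_eq C ((w @ v) @ [?x]) ([(letter_rng C (hd w), True)] @ [?x])"
      using path_eq.append[OF v(4) lx] vn v p ex by simp
    moreover have "path_eq C ([(letter_rng C (hd w), True)] @ [?x]) [?x]"
      using path_unit_left[OF lx] p ex by simp
    ultimately have "path_eq C (w @ v @ [?x]) [?x]" using path_eq.trans by fastforce
    then have "path_eq C ([x] @ (w @ v @ [?x])) ([x] @ [?x])"
      using path_eq.append[OF p(3)] p by simp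
    then have A: "path_eq C ((x # w) @ v @ [?x]) [(letter_rng C x, True)]"
      using path_eq.trans 1 by fastforce
    have "path_eq C ([?x, x] @ w) ([(letter_src C x, True)] @ w)"
      using path_eq.append[OF 2 p(1)] p by simp
    then have "path_eq C ([?x, x] @ w) w"
      using path_unit_left[OF p(1)] p path_eq.trans by fastforce
    then have "path_eq C (v @ ([?x, x] @ w)) (v @ w)"
      using path_eq.append[OF v(1)] v(3) p ex by simp
    then have B: "path_eq C ((v @ [?x]) @ (x # w)) [(letter_src C (last w), True)]"
      using path_eq.trans v(5) by fastforce
    show ?thesis using A B vx v p ex vn by (intro exI[of _ "v @ [?x]"]) simp
  qed
qed

lemma path_groupoid_rng:
  "is_path C w \<Longrightarrow> rng (path_groupoid C) (path_class C w) = path_class C [(letter_rng C (hd w), True)]"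
  using path_eq_ends[OF path_rep[of C w]] by (simp add: path_groupoid_def)

lemma path_groupoid_src:
  "is_path C w \<Longrightarrow> src (path_groupoid C) (path_class C w) = path_class C [(letter_src C (last w), True)]"
  using path_eq_ends[OF path_rep[of C w]] by (simp add: path_groupoid_def)

lemma path_groupoid_cmp:
  assumes "is_path C v" "is_path C w" "letter_src C (last v) = letter_rng C (hd w)"
  shows "cmp (path_groupoid C) (path_class C v) (path_class C w) = path_class C (v @ w)"
  using path_class_eqI[OF path_eq.append[OF path_rep[OF assms(1)] path_rep[OF assms(2)] assms(3)]]
  by (simp add: path_groupoid_def)

lemma path_groupoid_unit_inj:
  "u \<in> objects C \<Longrightarrow> v \<in> objects C \<Longrightarrow> path_class C [(u, True)] = path_class C [(v, True)] \<longleftrightarrow> u = v"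
  using path_class_eqD[OF is_path_unit, of v "[(u, True)]"] path_eq_ends[of "[(u, True)]" "[(v, True)]"]
  by (auto simp: cat_obj)

lemma path_groupoid_composable:
  assumes "is_path C v" "is_path C w"
  shows "src (path_groupoid C) (path_class C v) = rng (path_groupoid C) (path_class C w) \<longleftrightarrow>
    letter_src C (last v) = letter_rng C (hd w)"
  by (simp add: path_groupoid_src path_groupoid_rng assms path_groupoid_unit_inj path_ends_obj)

lemma path_groupoid_arrows: "A \<in> arrows (path_groupoid C) \<longleftrightarrow> (\<exists>w. is_path C w \<and> A = path_class C w)"
  by (auto simp: path_groupoid_def)

lemma path_groupoid_objects: "A \<in> objects (path_groupoid C) \<longleftrightarrow> (\<exists>u\<in>objects C. A = path_class C [(u, True)])"
  by (auto simp: path_groupoid_def)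

lemma groupoid_path_groupoid: "groupoid (path_groupoid C)"
proof -
  let ?G = "path_groupoid C"
  note s = path_groupoid_rng path_groupoid_src path_groupoid_cmp path_groupoid_composable
  have "small_category ?G"
    unfolding small_category_def
  proof (intro conjI ballI impI subsetI; (elim conjE)?)
    fix A assume "A \<in> objects ?G"
    then obtain u where u: "u \<in> objects C" "A = path_class C [(u, True)]"
      by (auto simp: path_groupoid_objects)
    then show "A \<in> arrows ?G" "rng ?G A = A" "src ?G A = A"
      using is_path_unit[OF u(1)] by (auto simp: path_groupoid_arrows s cat_obj)
  next
    fix A assume "A \<in> arrows ?G"
    then obtain v where v: "is_path C v" "A = path_class C v" by (auto simp: path_groupoid_arrows)
    show o: "rng ?G A \<in> objects ?G" "src ?G A \<in> objects ?G"
      using v path_ends_obj[OF v(1)] by (auto simp: path_groupoid_objects s)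
    note e = path_ends_obj[OF v(1)] is_path_unit[OF path_ends_obj(1)[OF v(1)]]
      is_path_unit[OF path_ends_obj(2)[OF v(1)]]
    show "cmp ?G (rng ?G A) A = A"
      using v e path_class_eqI[OF path_unit_left[OF v(1)]] by (simp add: s cat_obj)
    show "cmp ?G A (src ?G A) = A"
      using v e path_class_eqI[OF path_unit_right[OF v(1)]] by (simp add: s cat_obj)
    fix B assume "B \<in> arrows ?G"
    then obtain w where w: "is_path C w" "B = path_class C w" by (auto simp: path_groupoid_arrows)
    note n = path_eq_ends[OF v(1)] path_eq_ends[OF w(1)]
    { assume "src ?G A = rng ?G B"
      then have m: "letter_src C (last v) = letter_rng C (hd w)" using v w s by simp
      note vw = is_path_append[OF v(1) w(1) m]
      show "cmp ?G A B \<in> arrows ?G" "rng ?G (cmp ?G A B) = rng ?G A" "src ?G (cmp ?G A B) = src ?G B"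
        using v w m vw n by (auto simp: path_groupoid_arrows s) }
    fix D assume "D \<in> arrows ?G" and m: "src ?G A = rng ?G B" "src ?G B = rng ?G D"
    then obtain x where x: "is_path C x" "D = path_class C x" by (auto simp: path_groupoid_arrows)
    have m': "letter_src C (last v) = letter_rng C (hd w)" "letter_src C (last w) = letter_rng C (hd x)"
      using m v w x s by simp_all
    show "cmp ?G (cmp ?G A B) D = cmp ?G A (cmp ?G B D)"
      using v w x m' n is_path_append[OF v(1) w(1) m'(1)] is_path_append[OF w(1) x(1) m'(2)]
      by (simp add: s)
  qed
  moreover have "\<exists>B\<in>arrows ?G. rng ?G B = src ?G A \<and> src ?G B = rng ?G A \<and>
      cmp ?G A B = rng ?G A \<and> cmp ?G B A = src ?G A" if "A \<in> arrows ?G" for A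
  proof -
    from that obtain w where w: "is_path C w" "A = path_class C w" by (auto simp: path_groupoid_arrows)
    obtain v where v: "is_path C v" "letter_rng C (hd v) = letter_src C (last w)"
      "letter_src C (last v) = letter_rng C (hd w)"
      "path_eq C (w @ v) [(letter_rng C (hd w), True)]"
      "path_eq C (v @ w) [(letter_src C (last w), True)]"
      using path_inverse[OF w(1)] by blast
    show ?thesis
      using v w path_class_eqI[OF v(4)] path_class_eqI[OF v(5)]
      by (intro bexI[of _ "path_class C v"]) (auto simp: s path_groupoid_arrows)
  qed
  ultimately show ?thesis unfolding groupoid_def by blast
qed

definition path_map :: "'a \<Rightarrow> ('a \<times> bool) list set" where
  "path_map a = path_class C [(a, True)]"

lemma is_functor_path_map: "is_functor C (path_groupoid C) path_map"
  unfolding is_functor_def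
proof (intro conjI ballI impI)
  fix a assume a: "a \<in> arrows C"
  note l = path_eq.letter[OF a, of True]
  show "path_map a \<in> arrows (path_groupoid C)" using l by (auto simp: path_map_def path_groupoid_arrows)
  show "rng (path_groupoid C) (path_map a) = path_map (rng C a)"
    "src (path_groupoid C) (path_map a) = path_map (src C a)"
    using l by (simp_all add: path_map_def path_groupoid_rng path_groupoid_src)
  fix b assume b: "b \<in> arrows C" "src C a = rng C b"
  show "path_map (cmp C a b) = cmp (path_groupoid C) (path_map a) (path_map b)"
    using l path_eq.letter[OF b(1), of True] b path_class_eqI[OF path_eq.cmp[OF a b]]
    by (simp add: path_map_def path_groupoid_cmp)
next
  fix u assume "u \<in> objects C"
  then show "path_map u \<in> objects (path_groupoid C)" by (auto simp: path_map_def path_groupoid_objects)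
qed

end

subsection \<open>Universality of the groupoid of signed paths\<close>

lemma groupoid_small: "groupoid G \<Longrightarrow> small_category G"
  by (simp add: groupoid_def)

definition arrow_inv :: "('b, 'n) category_scheme \<Rightarrow> 'b \<Rightarrow> 'b" where
  "arrow_inv G a = (SOME b. b \<in> arrows G \<and> rng G b = src G a \<and> src G b = rng G a \<and>
     cmp G a b = rng G a \<and> cmp G b a = src G a)"

lemma arrow_inv:
  assumes "groupoid G" "a \<in> arrows G"
  shows "arrow_inv G a \<in> arrows G" "rng G (arrow_inv G a) = src G a" "src G (arrow_inv G a) = rng G a"
    "cmp G a (arrow_inv G a) = rng G a" "cmp G (arrow_inv G a) a = src G a"
proof -
  have "\<exists>b. b \<in> arrows G \<and> rng G b = src G a \<and> src G b = rng G a \<and>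
     cmp G a b = rng G a \<and> cmp G b a = src G a"
    using assms unfolding groupoid_def by blast
  from someI_ex[OF this, folded arrow_inv_def]
  show "arrow_inv G a \<in> arrows G" "rng G (arrow_inv G a) = src G a" "src G (arrow_inv G a) = rng G a"
    "cmp G a (arrow_inv G a) = rng G a" "cmp G (arrow_inv G a) a = src G a" by blast+
qed

lemma arrow_inv_unique:
  assumes G: "groupoid G" and a: "a \<in> arrows G" and b: "b \<in> arrows G" "rng G b = src G a"
    and e: "cmp G a b = rng G a"
  shows "b = arrow_inv G a"
proof -
  note S = groupoid_small[OF G]
  note i = arrow_inv[OF G a]
  have "b = cmp G (rng G b) b" using cat_unit[OF S b(1)] by simp
  also have "\<dots> = cmp G (cmp G (arrow_inv G a) a) b" using b i by simp
  also have "\<dots> = cmp G (arrow_inv G a) (cmp G a b)" using cat_assoc[OF S i(1) a b(1)] b(2) i by simp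
  also have "\<dots> = arrow_inv G a" using cat_unit[OF S i(1)] i e by simp
  finally show ?thesis .
qed

lemma functor_inv:
  assumes "groupoid G" "groupoid H" "is_functor G H F" "a \<in> arrows G"
  shows "F (arrow_inv G a) = arrow_inv H (F a)"
proof (rule arrow_inv_unique[OF assms(2)])
  note i = arrow_inv[OF assms(1,4)]
  note F = assms(3)[unfolded is_functor_def]
  show "F a \<in> arrows H" "F (arrow_inv G a) \<in> arrows H" using F assms(4) i(1) by simp_all
  show "rng H (F (arrow_inv G a)) = src H (F a)" using F assms(4) i(1,2) by simp
  show "cmp H (F a) (F (arrow_inv G a)) = rng H (F a)" using F assms(4) i(1,2,4) by metis
qed

fun letter_val :: "('b, 'n) category_scheme \<Rightarrow> ('a \<Rightarrow> 'b) \<Rightarrow> 'a \<times> bool \<Rightarrow> 'b" where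
  "letter_val G F (a, b) = (if b then F a else arrow_inv G (F a))"

fun path_val :: "('b, 'n) category_scheme \<Rightarrow> ('a \<Rightarrow> 'b) \<Rightarrow> ('a \<times> bool) list \<Rightarrow> 'b" where
  "path_val G F [] = undefined"
| "path_val G F [x] = letter_val G F x"
| "path_val G F (x # y # ys) = cmp G (letter_val G F x) (path_val G F (y # ys))"

context
  fixes C :: "('a, 'm) category_scheme" and G :: "('b, 'n) category_scheme" and F :: "'a \<Rightarrow> 'b"
  assumes C: "small_category C" and G: "groupoid G" and F: "is_functor C G F"
begin

lemma letter_val:
  assumes "fst x \<in> arrows C"
  shows "letter_val G F x \<in> arrows G \<and> rng G (letter_val G F x) = F (letter_rng C x) \<and>
    src G (letter_val G F x) = F (letter_src C x)"
  using F assms arrow_inv[OF G] by (cases x) (auto simp: is_functor_def)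

lemma path_val:
  "is_path C w \<Longrightarrow> path_val G F w \<in> arrows G \<and> rng G (path_val G F w) = F (letter_rng C (hd w)) \<and>
    src G (path_val G F w) = F (letter_src C (last w))"
proof (induction w rule: induct_list012)
  case 1
  then show ?case using path_eq_ends[OF C] by blast
next
  case (2 x)
  then show ?case using path_eq_ends[OF C 2] letter_val[of x] by simp
next
  case (3 x y ys)
  note p = is_path_Cons[OF C 3(3)]
  have "fst x \<in> arrows C" using path_eq_ends[OF C 3(3)] by simp
  note l = letter_val[OF this]
  show ?case using 3(2)[OF p(1)] l p(2) cat_cmp[OF groupoid_small[OF G]] by simp
qed

lemma path_val_append:
  "is_path C v \<Longrightarrow> is_path C w \<Longrightarrow> letter_src C (last v) = letter_rng C (hd w) \<Longrightarrow>
    path_val G F (v @ w) = cmp G (path_val G F v) (path_val G F w)"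
proof (induction v rule: induct_list012)
  case 1
  then show ?case using path_eq_ends[OF C] by blast
next
  case (2 x)
  then obtain y ys where "w = y # ys" using path_eq_ends[OF C 2(2)] by (cases w) auto
  then show ?case by simp
next
  case (3 x y ys)
  note p = is_path_Cons[OF C 3(3)]
  have "fst x \<in> arrows C" using path_eq_ends[OF C 3(3)] by simp
  note l = letter_val[OF this]
  have "path_val G F ((x # y # ys) @ w) = cmp G (letter_val G F x) (path_val G F ((y # ys) @ w))"
    by simp
  also have "\<dots> = cmp G (letter_val G F x) (cmp G (path_val G F (y # ys)) (path_val G F w))"
    using 3(2)[OF p(1) 3(4)] 3(5) by simp
  also have "\<dots> = cmp G (path_val G F (x # y # ys)) (path_val G F w)"
    using cat_assoc[OF groupoid_small[OF G]] l path_val[OF p(1)] path_val[OF 3(4)] p(2) 3(5) by simp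
  finally show ?case .
qed

lemma path_val_eq: "path_eq C v w \<Longrightarrow> path_val G F v = path_val G F w"
proof (induction rule: path_eq.induct)
  case (append u v u' v')
  have "letter_src C (last v) = letter_rng C (hd v')"
    using append path_eq_ends[OF C append.hyps(1)] path_eq_ends[OF C append.hyps(2)] by simp
  then show ?case
    using append path_val_append path_eq_left[OF append.hyps(1)] path_eq_right[OF append.hyps(1)]
      path_eq_left[OF append.hyps(2)] path_eq_right[OF append.hyps(2)] by metis
next
  case (cmp a b)
  then show ?case using F by (simp add: is_functor_def)
next
  case (inv a b)
  then show ?case using F arrow_inv[OF G, of "F a"] by (simp add: is_functor_def)
next
  case (unit a b)
  note l = letter_val[of "(a, b)"]
  show ?case using cat_unit[OF groupoid_small[OF G], of "letter_val G F (a, b)"] l unit by simp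
next
  case (unit' a b)
  note l = letter_val[of "(a, b)"]
  show ?case using cat_unit[OF groupoid_small[OF G], of "letter_val G F (a, b)"] l unit' by simp
qed simp_all

lemma path_val_rep: "is_path C w \<Longrightarrow> path_val G F (path_rep (path_class C w)) = path_val G F w"
  using path_val_eq[OF path_rep] by simp

lemma is_functor_path_val: "is_functor (path_groupoid C) G (\<lambda>A. path_val G F (path_rep A))"
  unfolding is_functor_def
proof (intro conjI ballI impI)
  let ?Q = "path_groupoid C"
  note s = path_groupoid_rng[OF C] path_groupoid_src[OF C] path_groupoid_cmp[OF C] path_val_rep
  fix A assume "A \<in> arrows ?Q"
  then obtain v where v: "is_path C v" "A = path_class C v" by (auto simp: path_groupoid_arrows[OF C])
  note u = is_path_unit[OF C path_ends_obj(1)[OF C v(1)]] is_path_unit[OF C path_ends_obj(2)[OF C v(1)]]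
  show "path_val G F (path_rep A) \<in> arrows G"
    "rng G (path_val G F (path_rep A)) = path_val G F (path_rep (rng ?Q A))"
    "src G (path_val G F (path_rep A)) = path_val G F (path_rep (src ?Q A))"
    using v u path_val by (simp_all add: s)
  fix B assume "B \<in> arrows ?Q" and m: "src ?Q A = rng ?Q B"
  then obtain w where w: "is_path C w" "B = path_class C w" by (auto simp: path_groupoid_arrows[OF C])
  have m': "letter_src C (last v) = letter_rng C (hd w)"
    using m v w path_groupoid_composable[OF C] by simp
  show "path_val G F (path_rep (cmp ?Q A B)) = cmp G (path_val G F (path_rep A)) (path_val G F (path_rep B))"
    using v w m' is_path_append[OF C v(1) w(1) m'] by (simp add: s path_val_append)
next
  fix A assume "A \<in> objects (path_groupoid C)"
  then obtain u where u: "u \<in> objects C" "A = path_class C [(u, True)]"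
    by (auto simp: path_groupoid_objects[OF C])
  then show "path_val G F (path_rep A) \<in> objects G"
    using F is_path_unit[OF C u(1)] by (simp add: path_val_rep is_functor_def)
qed

lemma functor_path_groupoid_eq:
  assumes H: "is_functor (path_groupoid C) G H" and e: "\<forall>a\<in>arrows C. H (path_map C a) = F a"
    and w: "is_path C w"
  shows "H (path_class C w) = path_val G F w"
  using w
proof (induction w rule: induct_list012)
  case 1
  then show ?case using path_eq_ends[OF C] by blast
next
  let ?Q = "path_groupoid C"
  note Q = groupoid_path_groupoid[OF C]
  have letter: "H (path_class C [x]) = letter_val G F x" if "fst x \<in> arrows C" for x
  proof -
    obtain a b where x: "x = (a, b)" by (cases x)
    have a: "a \<in> arrows C" using that x by simp
    have pa: "path_map C a \<in> arrows ?Q" using is_functor_path_map[OF C] a by (simp add: is_functor_def)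
    note l = path_eq.letter[OF a]
    have "path_class C [(a, False)] = arrow_inv ?Q (path_map C a)"
    proof (rule arrow_inv_unique[OF Q pa])
      show "path_class C [(a, False)] \<in> arrows ?Q" using l path_groupoid_arrows[OF C] by blast
      show "rng ?Q (path_class C [(a, False)]) = src ?Q (path_map C a)"
        using l by (simp add: path_map_def[OF C] path_groupoid_rng[OF C] path_groupoid_src[OF C])
      show "cmp ?Q (path_map C a) (path_class C [(a, False)]) = rng ?Q (path_map C a)"
        using l path_class_eqI[OF path_eq.inv[OF a, of True]]
        by (simp add: path_map_def[OF C] path_groupoid_rng[OF C] path_groupoid_cmp[OF C])
    qed
    then show ?thesis
      using x a e functor_inv[OF Q G H pa] by (cases b) (simp_all add: path_map_def[OF C])
  qed
  { case (2 x)
    then show ?case using path_eq_ends[OF C 2] letter[of x] by simp }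
  case (3 x y ys)
  note p = is_path_Cons[OF C 3(3)]
  have x: "fst x \<in> arrows C" using path_eq_ends[OF C 3(3)] by simp
  have "path_class C (x # y # ys) = cmp ?Q (path_class C [x]) (path_class C (y # ys))"
    using p by (simp add: path_groupoid_cmp[OF C])
  moreover have "src ?Q (path_class C [x]) = rng ?Q (path_class C (y # ys))"
    using p by (simp add: path_groupoid_composable[OF C])
  ultimately have "H (path_class C (x # y # ys)) = cmp G (H (path_class C [x])) (H (path_class C (y # ys)))"
    using H p path_groupoid_arrows[OF C] unfolding is_functor_def by metis
  then show ?case using letter[OF x] 3(2)[OF p(1)] by simp
qed

end

lemma fundamental_groupoid_wrtE:
  fixes G :: "'u category"
  assumes "fundamental_groupoid_wrt TYPE('u) C Q i" "groupoid G" "is_functor C G F"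
  obtains H where "is_functor Q G H" "\<forall>a\<in>arrows C. H (i a) = F a"
    "\<And>H' p. is_functor Q G H' \<Longrightarrow> \<forall>a\<in>arrows C. H' (i a) = F a \<Longrightarrow> p \<in> arrows Q \<Longrightarrow> H' p = H p"
proof -
  have "\<forall>(G :: 'u category) F. groupoid G \<and> is_functor C G F \<longrightarrow>
        (\<exists>H. is_functor Q G H \<and> (\<forall>a\<in>arrows C. H (i a) = F a) \<and>
           (\<forall>H'. is_functor Q G H' \<and> (\<forall>a\<in>arrows C. H' (i a) = F a) \<longrightarrow>
              (\<forall>p\<in>arrows Q. H' p = H p)))"
    using assms(1) unfolding fundamental_groupoid_wrt_def by (elim conjE)
  from this[THEN spec, THEN spec, THEN mp, OF conjI[OF assms(2,3)]]
  obtain H where H: "is_functor Q G H" "\<forall>a\<in>arrows C. H (i a) = F a"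
    "\<forall>H'. is_functor Q G H' \<and> (\<forall>a\<in>arrows C. H' (i a) = F a) \<longrightarrow> (\<forall>p\<in>arrows Q. H' p = H p)"
    by (elim exE conjE)
  show ?thesis by (rule that[OF H(1,2)]) (use H(3) in blast)
qed

theorem path_groupoid_universal:
  assumes C: "small_category C"
  shows "fundamental_groupoid_wrt TYPE('u) C (path_groupoid C) (path_map C)"
  unfolding fundamental_groupoid_wrt_def
proof (intro conjI allI impI; (elim conjE)?)
  show "groupoid (path_groupoid C)" "is_functor C (path_groupoid C) (path_map C)"
    using groupoid_path_groupoid is_functor_path_map C by blast+
  show "path_map C ` objects C = objects (path_groupoid C)"
    by (auto simp: path_groupoid_def path_map_def[OF C])
  fix G :: "'u category" and F
  assume G: "groupoid G" and F: "is_functor C G F"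
  note s = path_val_rep[OF C G F] functor_path_groupoid_eq[OF C G F]
  show "\<exists>H. is_functor (path_groupoid C) G H \<and> (\<forall>a\<in>arrows C. H (path_map C a) = F a) \<and>
     (\<forall>H'. is_functor (path_groupoid C) G H' \<and> (\<forall>a\<in>arrows C. H' (path_map C a) = F a) \<longrightarrow>
        (\<forall>p\<in>arrows (path_groupoid C). H' p = H p))"
  proof (intro exI[of _ "\<lambda>A. path_val G F (path_rep A)"] conjI allI impI ballI; (elim conjE)?)
    show "is_functor (path_groupoid C) G (\<lambda>A. path_val G F (path_rep A))"
      by (rule is_functor_path_val[OF C G F])
    show "path_val G F (path_rep (path_map C a)) = F a" if "a \<in> arrows C" for a
      using path_eq.letter[OF that, of True] by (simp add: path_map_def[OF C] s)
    show "H' p = path_val G F (path_rep p)"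
      if "is_functor (path_groupoid C) G H'" "\<forall>a\<in>arrows C. H' (path_map C a) = F a"
        "p \<in> arrows (path_groupoid C)" for H' p
      using that s by (auto simp: path_groupoid_arrows[OF C])
  qed
qed

theorem fundamental_groupoid_exists:
  assumes "small_category C"
  shows "\<exists>(Q :: ('a \<times> bool) list set category) i. fundamental_groupoid (C :: ('a, 'm) category_scheme) Q i"
  using path_groupoid_universal[OF assms] unfolding fundamental_groupoid_def by blast

subsection \<open>Independence of the type of test groupoids\<close>

definition transport_category :: "('b \<Rightarrow> 'c) \<Rightarrow> 'b category \<Rightarrow> 'c category" where
  "transport_category f G =
     \<lparr> arrows = f ` arrows G, objects = f ` objects G,
       rng = (\<lambda>x. f (rng G (the_inv f x))), src = (\<lambda>x. f (src G (the_inv f x))),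
       cmp = (\<lambda>x y. f (cmp G (the_inv f x) (the_inv f y))) \<rparr>"

lemma groupoid_transport:
  assumes f: "inj f" and G: "groupoid G"
  shows "groupoid (transport_category f G)"
proof -
  let ?T = "transport_category f G"
  note S = groupoid_small[OF G]
  have sel: "arrows ?T = f ` arrows G" "objects ?T = f ` objects G" "rng ?T (f a) = f (rng G a)"
    "src ?T (f a) = f (src G a)" "cmp ?T (f a) (f b) = f (cmp G a b)" for a b
    by (simp_all add: transport_category_def the_inv_f_f[OF f])
  have sub: "objects G \<subseteq> arrows G" using cat_obj[OF S] by blast
  have "small_category ?T"
    unfolding small_category_def sel ball_simps inj_eq[OF f]
    using sub cat_obj[OF S] cat_ends[OF S] cat_cmp[OF S] cat_unit[OF S] cat_assoc[OF S]
    by (simp add: sel inj_eq[OF f] image_mono inj_image_mem_iff[OF f])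
  moreover have "\<exists>B\<in>arrows ?T. rng ?T B = src ?T A \<and> src ?T B = rng ?T A \<and>
      cmp ?T A B = rng ?T A \<and> cmp ?T B A = src ?T A" if A: "A \<in> arrows ?T" for A
  proof -
    obtain a where a: "a \<in> arrows G" "A = f a" using A[unfolded sel(1)] by blast
    show ?thesis
      using arrow_inv[OF G a(1)] a(2) by (intro bexI[of _ "f (arrow_inv G a)"]) (simp_all add: sel)
  qed
  ultimately show ?thesis unfolding groupoid_def by blast
qed

lemma is_functor_comp: "is_functor A B F \<Longrightarrow> is_functor B D H \<Longrightarrow> is_functor A D (\<lambda>x. H (F x))"
  unfolding is_functor_def by simp

lemma is_functor_transport: "inj f \<Longrightarrow> is_functor G (transport_category f G) f"
  unfolding is_functor_def transport_category_def by (simp add: the_inv_f_f)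

lemma is_functor_transport': "inj f \<Longrightarrow> is_functor (transport_category f G) G (the_inv f)"
  unfolding is_functor_def transport_category_def by (auto simp: the_inv_f_f)

lemma fundamental_groupoid_wrt_inj:
  fixes f :: "'v \<Rightarrow> 'u"
  assumes U: "fundamental_groupoid_wrt TYPE('u) C Q i" and f: "inj f"
  shows "fundamental_groupoid_wrt TYPE('v) C Q i"
  unfolding fundamental_groupoid_wrt_def
proof (intro conjI allI impI; (elim conjE)?)
  show "groupoid Q" "is_functor C Q i" "i ` objects C = objects Q"
    using U by (simp_all add: fundamental_groupoid_wrt_def)
  fix G :: "'v category" and F
  assume G: "groupoid G" and F: "is_functor C G F"
  let ?T = "transport_category f G"
  obtain H where H: "is_functor Q ?T H" "\<forall>a\<in>arrows C. H (i a) = f (F a)"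
    "\<And>H' p. is_functor Q ?T H' \<Longrightarrow> \<forall>a\<in>arrows C. H' (i a) = f (F a) \<Longrightarrow> p \<in> arrows Q \<Longrightarrow> H' p = H p"
    by (rule fundamental_groupoid_wrtE[OF U groupoid_transport[OF f G] is_functor_comp[OF F is_functor_transport[OF f]]]) (rule that)
  show "\<exists>H. is_functor Q G H \<and> (\<forall>a\<in>arrows C. H (i a) = F a) \<and>
     (\<forall>H'. is_functor Q G H' \<and> (\<forall>a\<in>arrows C. H' (i a) = F a) \<longrightarrow> (\<forall>p\<in>arrows Q. H' p = H p))"
  proof (intro exI[of _ "\<lambda>x. the_inv f (H x)"] conjI allI impI ballI; (elim conjE)?)
    show "is_functor Q G (\<lambda>x. the_inv f (H x))"
      using is_functor_comp[OF H(1) is_functor_transport'[OF f]] .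
    show "the_inv f (H (i a)) = F a" if "a \<in> arrows C" for a using that H(2) by (simp add: the_inv_f_f f)
    show "H' p = the_inv f (H p)"
      if "is_functor Q G H'" "\<forall>a\<in>arrows C. H' (i a) = F a" "p \<in> arrows Q" for H' p
      using H(3)[OF is_functor_comp[OF that(1) is_functor_transport[OF f]] _ that(3)] that(2)
      by (metis the_inv_f_f f)
  qed
qed

theorem fundamental_groupoid_universal:
  fixes C :: "('a, 'm) category_scheme" and Q :: "'g category"
  assumes C: "small_category C" and Q: "fundamental_groupoid C Q i"
  shows "fundamental_groupoid_wrt TYPE('u) C Q i"
proof -
  let ?Z = "path_groupoid C" and ?j = "path_map C"
  have Qg: "fundamental_groupoid_wrt TYPE('g) C Q i"
    using Q fundamental_groupoid_wrt_inj[of C Q i Inl] by (simp add: fundamental_groupoid_def)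
  have Qz: "fundamental_groupoid_wrt TYPE(('a \<times> bool) list set) C Q i"
    using Q fundamental_groupoid_wrt_inj[of C Q i Inr] by (simp add: fundamental_groupoid_def)
  have gQ: "groupoid Q" and i: "is_functor C Q i" and o: "i ` objects C = objects Q"
    using Qg by (simp_all add: fundamental_groupoid_wrt_def)
  obtain Phi where Phi: "is_functor Q ?Z Phi" "\<forall>a\<in>arrows C. Phi (i a) = ?j a"
    by (rule fundamental_groupoid_wrtE[OF Qz groupoid_path_groupoid[OF C] is_functor_path_map[OF C]]) (rule that)
  obtain Psi where Psi: "is_functor ?Z Q Psi" "\<forall>a\<in>arrows C. Psi (?j a) = i a"
    by (rule fundamental_groupoid_wrtE[OF path_groupoid_universal[OF C] gQ i]) (rule that)
  have id: "Psi (Phi p) = p" if p: "p \<in> arrows Q" for p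
  proof -
    have 1: "is_functor Q Q (\<lambda>x. Psi (Phi x))" using is_functor_comp[OF Phi(1) Psi(1)] .
    have 2: "\<forall>a\<in>arrows C. Psi (Phi (i a)) = i a" using Phi Psi by simp
    have 3: "is_functor Q Q (\<lambda>x. x)" by (simp add: is_functor_def)
      obtain H where "is_functor Q Q H" "\<forall>a\<in>arrows C. H (i a) = i a"
        "\<And>H' p. is_functor Q Q H' \<Longrightarrow> \<forall>a\<in>arrows C. H' (i a) = i a \<Longrightarrow> p \<in> arrows Q \<Longrightarrow> H' p = H p"
      by (rule fundamental_groupoid_wrtE[OF Qg gQ i]) (rule that)
    from this(3)[OF 1 2 p] this(3)[OF 3 _ p] show ?thesis by simp
  qed
  show ?thesis
    unfolding fundamental_groupoid_wrt_def
  proof (intro conjI allI impI; (elim conjE)?)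
    show "groupoid Q" "is_functor C Q i" "i ` objects C = objects Q" by fact+
    fix G :: "'u category" and F
    assume G: "groupoid G" and F: "is_functor C G F"
    obtain K where K: "is_functor ?Z G K" "\<forall>a\<in>arrows C. K (?j a) = F a"
      "\<And>H' p. is_functor ?Z G H' \<Longrightarrow> \<forall>a\<in>arrows C. H' (?j a) = F a \<Longrightarrow> p \<in> arrows ?Z \<Longrightarrow> H' p = K p"
      by (rule fundamental_groupoid_wrtE[OF path_groupoid_universal[OF C] G F]) (rule that)
    show "\<exists>H. is_functor Q G H \<and> (\<forall>a\<in>arrows C. H (i a) = F a) \<and>
       (\<forall>H'. is_functor Q G H' \<and> (\<forall>a\<in>arrows C. H' (i a) = F a) \<longrightarrow> (\<forall>p\<in>arrows Q. H' p = H p))"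
    proof (intro exI[of _ "\<lambda>x. K (Phi x)"] conjI allI impI ballI; (elim conjE)?)
      show "is_functor Q G (\<lambda>x. K (Phi x))" using is_functor_comp[OF Phi(1) K(1)] .
      show "K (Phi (i a)) = F a" if "a \<in> arrows C" for a using that Phi K by simp
      show "H' p = K (Phi p)"
        if H': "is_functor Q G H'" "\<forall>a\<in>arrows C. H' (i a) = F a" and p: "p \<in> arrows Q" for H' p
      proof -
        have "Phi p \<in> arrows ?Z" using Phi(1) p by (simp add: is_functor_def)
        then have "H' (Psi (Phi p)) = K (Phi p)"
          using K(3)[OF is_functor_comp[OF Psi(1) H'(1)]] H'(2) Psi(2) by simp
        then show ?thesis using id[OF p] by simp
      qed
    qed
  qed
qed

end

theory Submission
  imports Defs
begin

text \<open>
  Oriented as rewriting rules, the relations (together with \<open>a\<^sub>x\<inverse> a\<^sub>y = a\<^sub>u a\<^sub>v\<inverse>\<close> for \<open>x \<noteq> y\<close>, which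
  comes from the line through \<open>x\<close> and \<open>y\<close>) form a terminating, locally confluent system whose
  irreducible words are the normal forms.  A rule either preserves the numbers of positive and of
  negative letters or shortens the word, so in a word of minimal length these numbers are the shape.
  Unique factorisation and the composition law of the 2-graph then become statements about minimal
  words.

  The cocycle is essential because \<open>w = c(w) s(w)\<close>.  Injectivity of \<open>i\<close> follows by mapping the
  2-graph to the transitive groupoid \<open>\<Lambda>\<^sup>0 \<times> \<Gamma> \<times> \<Lambda>\<^sup>0\<close> via \<open>w \<mapsto> (r(w), c(w), s(w))\<close>: this functor
  factors through \<open>i\<close>, and it is injective since \<open>c\<close> is essential.
\<close>

section \<open>Rewriting of signed words\<close>

text \<open>
  \<open>(x, y, z) \<in> T\<close> for some \<open>z\<close> means that \<open>y\<close> lies on the line \<open>\<lambda>(x)\<close>.  Thus \<open>ex_line\<close> says that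
  two points lie on a common line \<open>\<lambda>(s)\<close> and \<open>ex_meet\<close> that two lines meet; the uniqueness halves of
  both axioms of the plane are the single statement \<open>line_unique\<close>.
\<close>

locale triella_system =
  fixes P :: "'p set" and T :: "('p \<times> 'p \<times> 'p) set"
  assumes T_sub: "T \<subseteq> P \<times> P \<times> P"
    and T_rot: "(x, y, z) \<in> T \<Longrightarrow> (y, z, x) \<in> T"
    and T_fun: "(x, y, z) \<in> T \<Longrightarrow> (x, y, z') \<in> T \<Longrightarrow> z = z'"
    and ex_line: "x \<in> P \<Longrightarrow> y \<in> P \<Longrightarrow> x \<noteq> y \<Longrightarrow> \<exists>s u v. (s, x, u) \<in> T \<and> (s, y, v) \<in> T"
    and ex_meet: "x \<in> P \<Longrightarrow> y \<in> P \<Longrightarrow> x \<noteq> y \<Longrightarrow> \<exists>s u v. (x, s, u) \<in> T \<and> (y, s, v) \<in> T"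
    and line_unique: "(s, x, z1) \<in> T \<Longrightarrow> (s, y, z2) \<in> T \<Longrightarrow> (t, x, z3) \<in> T \<Longrightarrow> (t, y, z4) \<in> T \<Longrightarrow>
      x = y \<or> s = t"
begin

lemma T_P: "(x, y, z) \<in> T \<Longrightarrow> x \<in> P \<and> y \<in> P \<and> z \<in> P"
  using T_sub by blast

lemma T_fun2: "(x, y, z) \<in> T \<Longrightarrow> (x, y', z) \<in> T \<Longrightarrow> y = y'"
  using T_rot T_fun by metis

lemma T_fun1: "(x, y, z) \<in> T \<Longrightarrow> (x', y, z) \<in> T \<Longrightarrow> x = x'"
  using T_rot T_fun by metis

text \<open>Read with \<open>x\<close> standing for the generator \<open>a\<^sub>x\<close>, each
  rule is an identity in the group. In \<open>swap\<close>, rotating the first triple puts both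
  \<open>x\<close> and \<open>y\<close> on the line of \<open>s\<close>; then
  \<open>a\<^sub>x\<inverse> = a\<^sub>u a\<^sub>s\<close> and
  \<open>a\<^sub>s a\<^sub>y = a\<^sub>v\<inverse>\<close>.\<close>

inductive rule :: "'p \<times> bool \<Rightarrow> 'p \<times> bool \<Rightarrow> ('p \<times> bool) list \<Rightarrow> bool" where
  pp: "(x, y, z) \<in> T \<Longrightarrow> rule (x, True) (y, True) [(z, False)]"
| nn: "(y, x, z) \<in> T \<Longrightarrow> rule (x, False) (y, False) [(z, True)]"
| cancel: "x \<in> P \<Longrightarrow> rule (x, b) (x, \<not> b) []"
| swap: "(x, u, s) \<in> T \<Longrightarrow> (s, y, v) \<in> T \<Longrightarrow> x \<noteq> y \<Longrightarrow>
    rule (x, False) (y, True) [(u, True), (v, False)]"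

inductive step :: "('p \<times> bool) list \<Rightarrow> ('p \<times> bool) list \<Rightarrow> bool" where
  head: "rule a b r \<Longrightarrow> step (a # b # w) (r @ w)"
| tail: "step v w \<Longrightarrow> step (a # v) (a # w)"

abbreviation steps :: "('p \<times> bool) list \<Rightarrow> ('p \<times> bool) list \<Rightarrow> bool" where
  "steps \<equiv> step\<^sup>*\<^sup>*"

abbreviation joinable :: "('p \<times> bool) list \<Rightarrow> ('p \<times> bool) list \<Rightarrow> bool" where
  "joinable v w \<equiv> \<exists>t. steps v t \<and> steps w t"

inductive_cases rule_ppE: "rule (x, True) (y, True) r"
inductive_cases rule_nnE: "rule (x, False) (y, False) r"
inductive_cases rule_pnE: "rule (x, True) (y, False) r"
inductive_cases rule_npE: "rule (x, False) (y, True) r"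

text \<open>Only \<open>swap\<close> involves a choice, that of \<open>s\<close>. Distinct points
  lie on at most one common line, so \<open>line_unique\<close> fixes \<open>s\<close>, and two
  entries of a triple determine the third.\<close>

lemma rule_fun:
  assumes "rule a b r" "rule a b r'"
  shows "r = r'"
  using assms(1)
proof cases
  case (swap x u s y v)
  from assms(2) swap obtain u' s' v' where r': "r' = [(u', True), (v', False)]"
    "(x, u', s') \<in> T" "(s', y, v') \<in> T" by (auto elim: rule_npE)
  have "s = s'" using line_unique[of s x u y v s' u' v'] swap r' T_rot by blast
  then show ?thesis using swap r' T_fun T_fun2 by metis
next
  case pp
  then show ?thesis using assms(2) T_fun by (auto elim: rule_ppE)
next
  case nn
  then show ?thesis using assms(2) T_fun by (auto elim: rule_nnE)
next
  case (cancel x b)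
  then show ?thesis using assms(2) by (cases b) (auto elim: rule_npE rule_pnE)
qed

section \<open>Confluence of the rewriting system\<close>

lemma step_append_left: "step v w \<Longrightarrow> step (u @ v) (u @ w)"
  by (induction u) (auto intro: tail)

lemma step_append_right: "step v w \<Longrightarrow> step (v @ u) (w @ u)"
proof (induction rule: step.induct)
  case (head a b r w)
  then show ?case using step.head[of a b r "w @ u"] by simp
qed (auto intro: tail)

lemma steps_append_left: "steps v w \<Longrightarrow> steps (u @ v) (u @ w)"
  by (induction rule: rtranclp_induct) (auto intro: step_append_left rtranclp.rtrancl_into_rtrancl)

lemma steps_append_right: "steps v w \<Longrightarrow> steps (v @ u) (w @ u)"
  by (induction rule: rtranclp_induct) (auto intro: step_append_right rtranclp.rtrancl_into_rtrancl)

lemma steps_append: "steps v w \<Longrightarrow> steps v' w' \<Longrightarrow> steps (v @ v') (w @ w')"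
  using steps_append_left steps_append_right rtranclp_trans by metis

lemma rule_step: "rule a b r \<Longrightarrow> step [a, b] r"
  using head[of a b r "[]"] by simp

text \<open>The cases are the eight sign patterns of the three letters. Every overlap is closed by
  rotations of the triples that the two rules supply; the subcases separate the coincidences in
  which a \<open>swap\<close> degenerates to a cancellation.\<close>

lemma critical_pair:
  assumes 1: "rule a b r" and 2: "rule b c r'"
  shows "joinable (r @ [c]) (a # r')"
proof -
  obtain x p where a: "a = (x, p)" by (cases a)
  obtain y q where b: "b = (y, q)" by (cases b)
  obtain z k where c: "c = (z, k)" by (cases c)
  have sw: "steps [(x, False), (y, True)] [(u, True), (v, False)]"
    if "(x, u, s) \<in> T" "(s, y, v) \<in> T" "x \<noteq> y" for x y u v s
    using rule_step[OF swap[OF that]] by blast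
  have can: "steps [(x, b), (x, \<not> b)] []" if "x \<in> P" for x b
    using rule_step[OF cancel[OF that]] by blast
  have can1: "steps [(x, True), (x, False)] []" "steps [(x, False), (x, True)] []" if "x \<in> P" for x
    using can[OF that, of True] can[OF that, of False] by simp_all
  have pos: "steps [(x, True), (y, True)] [(z, False)]" if "(x, y, z) \<in> T" for x y z
    using rule_step[OF pp[OF that]] by blast
  have neg: "steps [(x, False), (y, False)] [(z, True)]" if "(y, x, z) \<in> T" for x y z
    using rule_step[OF nn[OF that]] by blast
  show ?thesis
  proof (cases p; cases q; cases k)
    assume s: p q k
    obtain w where w: "(x, y, w) \<in> T" "r = [(w, False)]" using 1 a b s by (auto elim: rule_ppE)
    obtain w' where w': "(y, z, w') \<in> T" "r' = [(w', False)]" using 2 b c s by (auto elim: rule_ppE)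
    show ?thesis
    proof (cases "w = z")
      case True
      then have "w' = x" using w w' T_rot T_fun by blast
      then show ?thesis using True w w' a c s can1[of x] can1[of z] T_P by fastforce
    next
      case False
      \<comment> \<open>The shared middle letter \<open>y\<close> serves as the \<open>s\<close> of
        \<open>swap\<close>, by the triples \<open>(w, x, y)\<close> and
        \<open>(y, z, w')\<close>.\<close>
      have "steps [(w, False), (z, True)] [(x, True), (w', False)]"
        using sw[of w x y z w'] T_rot w w' False by blast
      then show ?thesis using w w' a c s by auto
    qed
  next
    assume s: p q "\<not> k"
    obtain w where w: "(x, y, w) \<in> T" "r = [(w, False)]" using 1 a b s by (auto elim: rule_ppE)
    have r': "r' = []" "z = y" using 2 b c s by (auto elim: rule_pnE)
    have "steps [(w, False), (y, False)] [(x, True)]" using neg T_rot w by blast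
    then show ?thesis using w r' a c s by auto
  next
    assume s: p "\<not> q" k
    have r: "r = []" "x = y" "x \<in> P" using 1 a b s by (auto elim: rule_pnE)
    show ?thesis
    proof (cases "y = z")
      case True
      then have "r' = []" using 2 b c s by (auto elim: rule_npE)
      then show ?thesis using r True a c s by auto
    next
      case False
      then obtain u s0 v where u: "(y, u, s0) \<in> T" "(s0, z, v) \<in> T" "r' = [(u, True), (v, False)]"
        using 2 b c s by (auto elim: rule_npE)
      have "steps ([(y, True), (u, True)] @ [(v, False)]) ([(s0, False)] @ [(v, False)])"
        by (rule steps_append_right[OF pos[OF u(1)]])
      moreover have "steps [(s0, False), (v, False)] [(z, True)]" using neg u T_rot by blast
      ultimately have "steps [(y, True), (u, True), (v, False)] [(z, True)]"
        using rtranclp_trans by fastforce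
      then show ?thesis using r u a c s by auto
    qed
  next
    assume s: p "\<not> q" "\<not> k"
    have r: "r = []" "x = y" "x \<in> P" using 1 a b s by (auto elim: rule_pnE)
    obtain w where w: "(z, y, w) \<in> T" "r' = [(w, True)]" using 2 b c s by (auto elim: rule_nnE)
    have "steps [(x, True), (w, True)] [(z, False)]" using pos T_rot w r by blast
    then show ?thesis using w r a c s by auto
  next
    assume s: "\<not> p" q k
    obtain w where w: "(y, z, w) \<in> T" "r' = [(w, False)]" using 2 b c s by (auto elim: rule_ppE)
    show ?thesis
    proof (cases "x = y")
      case True
      then have r: "r = []" using 1 a b s by (auto elim: rule_npE)
      have "steps [(x, False), (w, False)] [(z, True)]" using neg T_rot w True by blast
      then show ?thesis using r w a c s by auto
    next
      case False
      then obtain u s0 v where u: "(x, u, s0) \<in> T" "(s0, y, v) \<in> T" "r = [(u, True), (v, False)]"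
        using 1 a b s by (auto elim: rule_npE)
      show ?thesis
      proof (cases "v = z")
        case True
        then have "s0 = w" using u w T_rot T_fun by blast
        then have "steps [(x, False), (w, False)] [(u, True)]" using neg u T_rot by blast
        moreover have "steps ([(u, True)] @ [(v, False), (z, True)]) ([(u, True)] @ [])"
          by (rule steps_append_left) (use True can1 T_P u in blast)
        ultimately show ?thesis using u w a c s by auto
      next
        case False
        have "steps [(v, False), (z, True)] [(s0, True), (w, False)]"
          using sw[of v s0 y z w] T_rot u w False by blast
        then have "steps ([(u, True)] @ [(v, False), (z, True)]) ([(u, True)] @ [(s0, True), (w, False)])"
          by (rule steps_append_left)
        moreover have "steps ([(u, True), (s0, True)] @ [(w, False)]) ([(x, False)] @ [(w, False)])"
          by (rule steps_append_right) (use pos u T_rot in blast)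
        ultimately have "steps [(u, True), (v, False), (z, True)] [(x, False), (w, False)]"
          using rtranclp_trans by fastforce
        then show ?thesis using u w a c s by auto
      qed
    qed
  next
    assume s: "\<not> p" q "\<not> k"
    have r': "r' = []" "y = z" using 2 b c s by (auto elim: rule_pnE)
    show ?thesis
    proof (cases "x = y")
      case True
      then have "r = []" using 1 a b s by (auto elim: rule_npE)
      then show ?thesis using r' True a c s by auto
    next
      case False
      then obtain u s0 v where u: "(x, u, s0) \<in> T" "(s0, y, v) \<in> T" "r = [(u, True), (v, False)]"
        using 1 a b s by (auto elim: rule_npE)
      have "steps ([(u, True)] @ [(v, False), (y, False)]) ([(u, True)] @ [(s0, True)])"
        by (rule steps_append_left) (use neg u T_rot in blast)
      moreover have "steps [(u, True), (s0, True)] [(x, False)]" using pos u T_rot by blast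
      ultimately have "steps [(u, True), (v, False), (y, False)] [(x, False)]"
        using rtranclp_trans by fastforce
      then show ?thesis using r' u a c s by auto
    qed
  next
    assume s: "\<not> p" "\<not> q" k
    obtain w where w: "(y, x, w) \<in> T" "r = [(w, True)]" using 1 a b s by (auto elim: rule_nnE)
    show ?thesis
    proof (cases "y = z")
      case True
      then have r': "r' = []" using 2 b c s by (auto elim: rule_npE)
      have "steps [(w, True), (z, True)] [(x, False)]" using pos T_rot w True by blast
      then show ?thesis using r' w a c s by auto
    next
      case False
      then obtain u s0 v where u: "(y, u, s0) \<in> T" "(s0, z, v) \<in> T" "r' = [(u, True), (v, False)]"
        using 2 b c s by (auto elim: rule_npE)
      show ?thesis
      proof (cases "x = u")
        case True
        then have "s0 = w" using u w T_fun by blast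
        then have "steps [(w, True), (z, True)] [(v, False)]" using pos u T_rot by blast
        moreover have "steps ([(x, False), (u, True)] @ [(v, False)]) ([] @ [(v, False)])"
          by (rule steps_append_right) (use True can1 T_P u in blast)
        ultimately show ?thesis using u w a c s by auto
      next
        case False
        have "steps [(x, False), (u, True)] [(w, True), (s0, False)]"
          using sw[of x w y u s0] T_rot u w False by blast
        then have "steps ([(x, False), (u, True)] @ [(v, False)]) ([(w, True), (s0, False)] @ [(v, False)])"
          by (rule steps_append_right)
        moreover have "steps ([(w, True)] @ [(s0, False), (v, False)]) ([(w, True)] @ [(z, True)])"
          by (rule steps_append_left) (use neg u T_rot in blast)
        ultimately have "steps [(x, False), (u, True), (v, False)] [(w, True), (z, True)]"
          using rtranclp_trans by fastforce
        then show ?thesis using u w a c s by auto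
      qed
    qed
  next
    assume s: "\<not> p" "\<not> q" "\<not> k"
    obtain w where w: "(y, x, w) \<in> T" "r = [(w, True)]" using 1 a b s by (auto elim: rule_nnE)
    obtain w' where w': "(z, y, w') \<in> T" "r' = [(w', True)]" using 2 b c s by (auto elim: rule_nnE)
    show ?thesis
    proof (cases "x = w'")
      case True
      then have "w = z" using w w' T_rot T_fun by blast
      then show ?thesis using True w w' a c s can1[of x] can1[of z] T_P by fastforce
    next
      case False
      have "steps [(x, False), (w', True)] [(w, True), (z, False)]"
        using sw[of x w y w' z] T_rot w w' False by blast
      then show ?thesis using w w' a c s by auto
    qed
  qed
qed

text \<open>Two steps in one word act at the same place, where \<open>rule_fun\<close> applies, or
  overlap in one letter, where \<open>critical_pair\<close> applies, or act on disjoint parts and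
  commute. The induction moves past the common prefix.\<close>

lemma locally_confluent: "step w w1 \<Longrightarrow> step w w2 \<Longrightarrow> joinable w1 w2"
proof (induction arbitrary: w2 rule: step.induct)
  case (head a b r w)
  from head(2) show ?case
  proof cases
    case (head r')
    then show ?thesis using rule_fun \<open>rule a b r\<close> by blast
  next
    case (tail w')
    from tail(2) show ?thesis
    proof cases
      case (head c r' v)
      obtain t where "steps (r @ [c]) t" "steps (a # r') t"
        using critical_pair \<open>rule a b r\<close> head by blast
      then have "steps ((r @ [c]) @ v) (t @ v)" "steps ((a # r') @ v) (t @ v)"
        using steps_append_right by blast+
      then show ?thesis using tail head by auto
    next
      case (tail v)
      have "steps (r @ w) (r @ v)" using tail step_append_left by blast
      moreover have "step (a # b # v) (r @ v)" using step.head \<open>rule a b r\<close> by blast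
      ultimately show ?thesis using tail \<open>w2 = a # w'\<close> by blast
    qed
  qed
next
  case (tail v w a)
  from tail(3) show ?case
  proof cases
    case (head b r' v')
    from \<open>step v w\<close> head(1) have "step (b # v') w" by simp
    then show ?thesis
    proof cases
      case (head c r v'')
      obtain t where "steps (r' @ [c]) t" "steps (a # r) t"
        using critical_pair head \<open>rule a b r'\<close> by blast
      then have "steps ((r' @ [c]) @ v'') (t @ v'')" "steps ((a # r) @ v'') (t @ v'')"
        using steps_append_right by blast+
      then show ?thesis using \<open>w2 = r' @ v'\<close> head by auto
    next
      case (tail v1)
      have "steps (r' @ v') (r' @ v1)" using tail step_append_left by blast
      moreover have "step (a # b # v1) (r' @ v1)" using step.head \<open>rule a b r'\<close> by blast
      ultimately show ?thesis using tail \<open>w2 = r' @ v'\<close> by blast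
    qed
  next
    case (tail w')
    then obtain t where "steps w t" "steps w' t" using tail.IH \<open>\<And>w2. step v w2 \<Longrightarrow> joinable w w2\<close> by blast
    then have "steps ([a] @ w) ([a] @ t)" "steps ([a] @ w') ([a] @ t)" using steps_append_left by blast+
    then show ?thesis using tail by auto
  qed
qed

text \<open>
  The rule \<open>swap\<close> keeps the length; it lowers this weight because negative letters act on the weight
  of what follows by doubling.
\<close>

fun inversion_weight :: "('p \<times> bool) list \<Rightarrow> nat" where
  "inversion_weight [] = 0"
| "inversion_weight (a # w) = (if snd a then inversion_weight w + 1 else 2 * inversion_weight w + 1)"

lemma step_decreasing: "step v w \<Longrightarrow>
    length w < length v \<or> length w = length v \<and> inversion_weight w < inversion_weight v"
proof (induction rule: step.induct)
  case (head a b r w)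
  then show ?case by cases auto
qed auto

lemma wf_step: "wfP (\<lambda>w v. step v w)"
proof (rule wfp_subset)
  show "wfP (\<lambda>w v. (w, v) \<in> measures [length, inversion_weight])"
    using wf_measures[of "[length, inversion_weight]"]
    by (simp only: wfp_def Collect_mem_eq split_def prod.collapse)
  show "(\<lambda>w v. step v w) \<le> (\<lambda>w v. (w, v) \<in> measures [length, inversion_weight])"
    using step_decreasing by auto
qed

text \<open>This is Newman's lemma: the first steps are joined locally at \<open>t\<close>, and the
  induction hypothesis is applied first at \<open>w1\<close> and then at \<open>w2\<close>.\<close>

lemma confluent: "steps w v1 \<Longrightarrow> steps w v2 \<Longrightarrow> joinable v1 v2"
proof (induction w arbitrary: v1 v2 rule: wfp_induct_rule[OF wf_step])
  case (1 w)
  show ?case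
  proof (cases "v1 = w \<or> v2 = w")
    case True
    then show ?thesis using 1(2,3) by blast
  next
    case False
    obtain w1 where w1: "step w w1" "steps w1 v1" using 1(2) False by (blast elim: converse_rtranclpE)
    obtain w2 where w2: "step w w2" "steps w2 v2" using 1(3) False by (blast elim: converse_rtranclpE)
    note w = w1 w2
    obtain t where t: "steps w1 t" "steps w2 t" using locally_confluent w by blast
    obtain t1 where t1: "steps v1 t1" "steps t t1" using 1(1)[OF w(1) w(2) t(1)] by blast
    have "steps w2 t1" using t(2) t1(2) by simp
    then obtain t2 where "steps t1 t2" "steps v2 t2" using 1(1)[OF w(3) _ w(4)] by blast
    then show ?thesis using t1(1) by (meson rtranclp_trans)
  qed
qed

section \<open>Normal forms and geodesic words\<close>

abbreviation words :: "('p \<times> bool) list set" where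
  "words \<equiv> lists (P \<times> UNIV)"

abbreviation weq :: "('p \<times> bool) list \<Rightarrow> ('p \<times> bool) list \<Rightarrow> bool" where
  "weq \<equiv> pres_eq P (triella_relators T)"

definition inc :: "'p \<Rightarrow> 'p \<Rightarrow> bool" where
  "inc x y \<longleftrightarrow> (\<exists>z. (x, y, z) \<in> T)"

abbreviation pos :: "'p list \<Rightarrow> ('p \<times> bool) list" where
  "pos xs \<equiv> map (\<lambda>x. (x, True)) xs"

abbreviation neg :: "'p list \<Rightarrow> ('p \<times> bool) list" where
  "neg ys \<equiv> map (\<lambda>y. (y, False)) ys"

text \<open>Incidence is expressed by \<open>inc\<close>, without lines, so that the same notion is
  available for the dual triella.\<close>

definition normal :: "'p list \<Rightarrow> 'p list \<Rightarrow> bool" where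
  "normal xs ys \<longleftrightarrow> set xs \<subseteq> P \<and> set ys \<subseteq> P \<and>
     successively (\<lambda>x x'. \<not> inc x x') xs \<and> successively (\<lambda>y y'. \<not> inc y' y) ys \<and>
     (xs \<noteq> [] \<and> ys \<noteq> [] \<longrightarrow> last xs \<noteq> hd ys)"

definition weight :: "('p \<times> bool) list \<Rightarrow> nat \<times> nat" where
  "weight w = (length (filter snd w), length (filter (Not \<circ> snd) w))"

lemma weight_simps [simp]:
  "weight [] = 0" "weight (v @ w) = weight v + weight w" "weight (pos xs) = (length xs, 0)"
  "weight (neg ys) = (0, length ys)" "weight ((x, True) # w) = (1, 0) + weight w"
  "weight ((x, False) # w) = (0, 1) + weight w"
  by (simp_all add: weight_def zero_prod_def filter_map comp_def)

lemma length_weight: "length w = fst (weight w) + snd (weight w)"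
  unfolding weight_def comp_def using sum_length_filter_compl[of snd w] by simp

lemma words_iff: "w \<in> words \<longleftrightarrow> set w \<subseteq> P \<times> UNIV"
  by auto

lemma weq_words: "weq v w \<Longrightarrow> v \<in> words \<and> w \<in> words"
  using pres_eq_words words_iff by metis

lemma weq_refl: "w \<in> words \<Longrightarrow> weq w w"
  using pres_eq.refl words_iff by metis

lemma weq_append_left: "weq v w \<Longrightarrow> u \<in> words \<Longrightarrow> weq (u @ v) (u @ w)"
  using pres_eq.append weq_refl by metis

lemma weq_append_right: "weq v w \<Longrightarrow> u \<in> words \<Longrightarrow> weq (v @ u) (w @ u)"
  using pres_eq.append weq_refl by metis

lemma weq_cancel: "x \<in> P \<Longrightarrow> weq [(x, b), (x, \<not> b)] []"
  by (rule pres_eq.cancel)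

lemma weq_move_left:
  assumes "weq ((x, b) # v) w"
  shows "weq v ((x, \<not> b) # w)"
proof -
  have x: "x \<in> P" "v \<in> words" using weq_words[OF assms] by auto
  have "weq ([(x, \<not> b)] @ ((x, b) # v)) ([(x, \<not> b)] @ w)"
    using weq_append_left[OF assms, of "[(x, \<not> b)]"] x by simp
  moreover have "weq ([(x, \<not> b), (x, b)] @ v) ([] @ v)"
    using weq_append_right[OF weq_cancel[of x "\<not> b"]] x by simp
  ultimately show ?thesis by (auto intro: pres_eq.trans pres_eq.sym)
qed

lemma weq_triangle:
  assumes "(x, y, z) \<in> T"
  shows "weq [(x, True), (y, True)] [(z, False)]" "weq [(y, False), (x, False)] [(z, True)]"
proof -
  have rel: "weq [(a, True), (b, True), (c, True)] []" if "(a, b, c) \<in> T" for a b c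
    using that T_P by (intro pres_eq.relator) (auto simp: triella_relators_def)
  have "weq [(z, True), (x, True), (y, True)] []" using rel T_rot assms by blast
  from weq_move_left[OF this] show "weq [(x, True), (y, True)] [(z, False)]" by simp
  have "weq [(z, True)] [(y, False), (x, False)]"
    using weq_move_left[OF weq_move_left[OF rel[OF assms]]] by simp
  then show "weq [(y, False), (x, False)] [(z, True)]" by (rule pres_eq.sym)
qed

lemma rule_weq: "rule a b r \<Longrightarrow> weq [a, b] r"
proof (induction rule: rule.induct)
  case (swap x u s y v)
  have P: "x \<in> P" "u \<in> P" "s \<in> P" "y \<in> P" "v \<in> P" using swap T_P by blast+
  have "weq ([(x, False)] @ [(y, True)]) ([(u, True), (s, True)] @ [(y, True)])"
    using weq_append_right[OF pres_eq.sym[OF weq_triangle(1)[of u s x]]] swap T_rot P by auto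
  moreover have "weq ([(u, True)] @ [(s, True), (y, True)]) ([(u, True)] @ [(v, False)])"
    using weq_append_left[OF weq_triangle(1)[of s y v], of "[(u, True)]"] swap P by auto
  ultimately show ?case using pres_eq.trans by fastforce
qed (auto intro: weq_triangle weq_cancel)

lemma step_weq: "step v w \<Longrightarrow> v \<in> words \<Longrightarrow> weq v w"
proof (induction rule: step.induct)
  case (head a b r w)
  then show ?case using weq_append_right[OF rule_weq[OF head(1)], of w] by simp
next
  case (tail v w a)
  then show ?case using weq_append_left[of v w "[a]"] by simp
qed

lemma steps_weq: "steps v w \<Longrightarrow> v \<in> words \<Longrightarrow> weq v w"
proof (induction rule: rtranclp_induct)
  case (step y z)
  then show ?case using step_weq weq_words pres_eq.trans by blast
qed (rule weq_refl)

text \<open>This is the Church-Rosser property, which reduces equality in the group to rewriting.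
  Confluence enters in the case \<open>trans\<close> alone; a relator reduces to the empty word in
  two steps.\<close>

lemma weq_joinable: "weq v w \<Longrightarrow> joinable v w"
proof (induction rule: pres_eq.induct)
  case (trans u v w)
  then show ?case using confluent by (meson rtranclp_trans)
next
  case (append u v u' v')
  then show ?case using steps_append by blast
next
  case (cancel x b)
  then show ?case using rule_step[OF rule.cancel] by blast
next
  case (relator r)
  then obtain x y z where r: "r = [(x, True), (y, True), (z, True)]" "(x, y, z) \<in> T"
    unfolding triella_relators_def by auto
  have "step ([(x, True), (y, True)] @ [(z, True)]) ([(z, False)] @ [(z, True)])"
    using step_append_right[OF rule_step[OF pp[OF r(2)]]] .
  moreover have "step [(z, False), (z, True)] []"
    using rule_step[OF rule.cancel[of z False]] r T_P by simp
  ultimately have "steps r []" unfolding r by (simp add: converse_rtranclp_into_rtranclp)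
  then show ?case by blast
qed blast+

definition irreducible :: "('p \<times> bool) list \<Rightarrow> bool" where
  "irreducible w \<longleftrightarrow> (\<forall>v. \<not> step w v)"

lemma irreducible_iff: "irreducible w \<longleftrightarrow> successively (\<lambda>a b. \<forall>r. \<not> rule a b r) w"
proof (induction w rule: induct_list012)
  case (3 a b w)
  have "(\<exists>v. step (a # b # w) v) \<longleftrightarrow> (\<exists>r. rule a b r) \<or> (\<exists>v. step (b # w) v)"
    by (auto elim: step.cases intro: step.intros)
  then show ?case using 3 by (auto simp: irreducible_def)
qed (auto simp: irreducible_def elim: step.cases)

text \<open>The first three parts are the three conditions of a normal form. The last rests on
  \<open>ex_line\<close>: a negative letter directly before a positive one can always be rewritten,
  so irreducible words have their positive letters first.\<close>

lemma no_rule_iff: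
  assumes "x \<in> P" "y \<in> P"
  shows "(\<forall>r. \<not> rule (x, True) (y, True) r) \<longleftrightarrow> \<not> inc x y"
    "(\<forall>r. \<not> rule (x, False) (y, False) r) \<longleftrightarrow> \<not> inc y x"
    "(\<forall>r. \<not> rule (x, True) (y, False) r) \<longleftrightarrow> x \<noteq> y"
    "\<exists>r. rule (x, False) (y, True) r"
proof -
  show "\<exists>r. rule (x, False) (y, True) r"
  proof (cases "x = y")
    case True
    then show ?thesis using rule.cancel[of x False] assms by auto
  next
    case False
    then obtain s u v where "(s, x, u) \<in> T" "(s, y, v) \<in> T" using ex_line assms by blast
    then show ?thesis using swap[of x u s y v] T_rot False by blast
  qed
  show "(\<forall>r. \<not> rule (x, True) (y, False) r) \<longleftrightarrow> x \<noteq> y"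
    using rule.cancel[of x True] assms by (auto elim: rule_pnE)
qed (auto simp: inc_def elim: rule_ppE rule_nnE intro: pp nn)

lemma irreducible_pos_neg_iff:
  assumes "pos xs @ neg ys \<in> words"
  shows "irreducible (pos xs @ neg ys) \<longleftrightarrow> normal xs ys"
proof -
  have P: "set xs \<subseteq> P" "set ys \<subseteq> P" using assms by auto
  have "successively (\<lambda>x y. \<forall>r. \<not> rule (x, True) (y, True) r) xs \<longleftrightarrow> successively (\<lambda>x y. \<not> inc x y) xs"
    using no_rule_iff(1) subsetD[OF P(1)] by (intro successively_cong HOL.refl) blast
  moreover have "successively (\<lambda>x y. \<forall>r. \<not> rule (x, False) (y, False) r) ys \<longleftrightarrow>
      successively (\<lambda>x y. \<not> inc y x) ys"
    using no_rule_iff(2) subsetD[OF P(2)] by (intro successively_cong HOL.refl) blast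
  moreover have "(\<forall>r. \<not> rule (last xs, True) (hd ys, False) r) \<longleftrightarrow> last xs \<noteq> hd ys"
    if "xs \<noteq> []" "ys \<noteq> []"
    using that P no_rule_iff(3) by (simp add: subset_iff)
  ultimately show ?thesis
    using P unfolding irreducible_iff normal_def
    by (auto simp: successively_append_iff successively_map last_map hd_map)
qed

lemma irreducible_form:
  "w \<in> words \<Longrightarrow> irreducible w \<Longrightarrow> \<exists>xs ys. w = pos xs @ neg ys"
proof (induction w)
  case Nil
  show ?case by (intro exI[of _ "[]"]) simp
next
  case (Cons a w)
  obtain x b where a: "a = (x, b)" by (cases a)
  have "irreducible w" using Cons.prems(2) step.tail unfolding irreducible_def by blast
  then obtain xs ys where w: "w = pos xs @ neg ys" using Cons by auto
  show ?case
  proof (cases b)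
    case True
    then show ?thesis using w a by (intro exI[of _ "x # xs"] exI[of _ ys]) simp
  next
    case False
    have "xs = []"
    proof (cases xs)
      case (Cons y zs)
      then have "\<exists>r. rule a (y, True) r" using no_rule_iff(4) \<open>a # w \<in> words\<close> a w False by auto
      then show ?thesis using \<open>irreducible (a # w)\<close> w Cons step.head
        unfolding irreducible_def by fastforce
    qed
    then show ?thesis using w a False by (intro exI[of _ "[]"] exI[of _ "x # ys"]) simp
  qed
qed

lemma normal_words: "normal xs ys \<Longrightarrow> pos xs @ neg ys \<in> words"
  by (auto simp: normal_def)

lemma normal_irreducible: "normal xs ys \<Longrightarrow> irreducible (pos xs @ neg ys)"
  using irreducible_pos_neg_iff normal_words by blast

lemma ex_irreducible: "\<exists>v. steps w v \<and> irreducible v"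
proof (induction w rule: wfp_induct_rule[OF wf_step])
  case (1 w)
  show ?case
  proof (cases "irreducible w")
    case False
    then obtain v where "step w v" unfolding irreducible_def by blast
    then show ?thesis using 1 converse_rtranclp_into_rtranclp by metis
  qed blast
qed

lemma normal_form_exists:
  assumes "w \<in> words"
  shows "\<exists>xs ys. normal xs ys \<and> steps w (pos xs @ neg ys)"
proof -
  obtain v where v: "steps w v" "irreducible v" using ex_irreducible by blast
  then have "v \<in> words" using steps_weq assms weq_words by blast
  then show ?thesis using irreducible_form[of v] irreducible_pos_neg_iff v by metis
qed

lemma steps_irreducible: "irreducible w \<Longrightarrow> steps w v \<Longrightarrow> v = w"
  unfolding irreducible_def by (erule converse_rtranclpE) auto

lemma pos_neg_inject: "pos xs @ neg ys = pos xs' @ neg ys' \<longleftrightarrow> xs = xs' \<and> ys = ys'"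
proof
  assume e: "pos xs @ neg ys = pos xs' @ neg ys'"
  have "map fst (filter snd (pos xs @ neg ys)) = map fst (filter snd (pos xs' @ neg ys'))"
    "map fst (filter (Not \<circ> snd) (pos xs @ neg ys)) = map fst (filter (Not \<circ> snd) (pos xs' @ neg ys'))"
    unfolding e by simp_all
  then show "xs = xs' \<and> ys = ys'" by (simp add: filter_map comp_def)
qed simp

lemma weq_normal_steps:
  assumes "normal xs ys" "weq w (pos xs @ neg ys)"
  shows "steps w (pos xs @ neg ys)"
  using weq_joinable[OF assms(2)] steps_irreducible[OF normal_irreducible[OF assms(1)]] by blast

lemma normal_unique:
  assumes "normal xs ys" "normal xs' ys'" "weq (pos xs @ neg ys) (pos xs' @ neg ys')"
  shows "xs = xs' \<and> ys = ys'"
  using steps_irreducible[OF normal_irreducible[OF assms(1)] weq_normal_steps[OF assms(2,3)]]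
  by (simp only: pos_neg_inject)

section \<open>Words of minimal length\<close>

lemma step_weight: "step v w \<Longrightarrow> length w < length v \<or> length w = length v \<and> weight w = weight v"
proof (induction rule: step.induct)
  case (head a b r w)
  then show ?case by cases (auto simp: add.assoc[symmetric])
next
  case (tail v w a)
  then show ?case by (cases a; cases "snd a") auto
qed

lemma steps_weight: "steps v w \<Longrightarrow> length w < length v \<or> length w = length v \<and> weight w = weight v"
proof (induction rule: rtranclp_induct)
  case (step y z)
  then show ?case using step_weight[OF step(2)] by auto
qed simp

definition geodesic :: "('p \<times> bool) list \<Rightarrow> bool" where
  "geodesic w \<longleftrightarrow> w \<in> words \<and> (\<forall>v. weq w v \<longrightarrow> length w \<le> length v)"

text \<open>Every word for the same element reduces to the normal form, and no rule lengthens a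
  word.\<close>

lemma normal_geodesic:
  assumes "normal xs ys"
  shows "geodesic (pos xs @ neg ys)"
  unfolding geodesic_def
proof (intro conjI allI impI)
  fix v assume "weq (pos xs @ neg ys) v"
  then have "steps v (pos xs @ neg ys)" using weq_normal_steps[OF assms] pres_eq.sym by blast
  then show "length (pos xs @ neg ys) \<le> length v" using steps_weight by fastforce
qed (rule normal_words[OF assms])

lemma geodesic_weq: "geodesic v \<Longrightarrow> weq v w \<Longrightarrow> length w \<le> length v \<Longrightarrow> geodesic w"
  unfolding geodesic_def using pres_eq.trans[of P _ v w] weq_words le_trans by blast

lemma geodesic_append:
  assumes "geodesic (v @ w)"
  shows "geodesic v" "geodesic w"
proof -
  have vw: "v \<in> words" "w \<in> words" using assms by (auto simp: geodesic_def)
  have "length v \<le> length v'" if "weq v v'" for v'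
    using weq_append_right[OF that vw(2)] assms unfolding geodesic_def by fastforce
  then show "geodesic v" using vw unfolding geodesic_def by blast
  have "length w \<le> length w'" if "weq w w'" for w'
    using weq_append_left[OF that vw(1)] assms unfolding geodesic_def by fastforce
  then show "geodesic w" using vw unfolding geodesic_def by blast
qed

text \<open>The reduction of a geodesic word to its normal form cannot shorten it, so each of its
  steps preserves the weight. Hence any geodesic word can be used to compute the shape.\<close>

lemma geodesic_normal_form:
  assumes "geodesic w"
  obtains xs ys where "normal xs ys" "weq w (pos xs @ neg ys)" "weight w = (length xs, length ys)"
proof -
  have w: "w \<in> words" using assms by (simp add: geodesic_def)
  obtain xs ys where n: "normal xs ys" "steps w (pos xs @ neg ys)" using normal_form_exists[OF w] by blast
  have e: "weq w (pos xs @ neg ys)" using steps_weq n w by blast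
  then have "length w \<le> length (pos xs @ neg ys)" using assms unfolding geodesic_def by blast
  then have "weight w = (length xs, length ys)" using steps_weight[OF n(2)] by auto
  then show ?thesis using that n e by blast
qed

text \<open>With all positive letters in front, \<open>swap\<close> has no place to act, and every
  other rule shortens the word. A geodesic word of this form is therefore irreducible.\<close>

lemma step_pos_neg: "step v w \<Longrightarrow> v = pos xs @ neg ys \<Longrightarrow> length w < length v"
proof (induction arbitrary: xs ys rule: step.induct)
  case (head a b r w)
  then show ?case
    by cases (auto simp: Cons_eq_append_conv append_eq_Cons_conv Cons_eq_map_conv)
next
  case (tail v w a)
  from tail.prems have "\<exists>xs ys. v = pos xs @ neg ys"
  proof (cases xs)
    case Nil
    then have "v = pos [] @ neg (tl ys)" using tail.prems by (cases ys) auto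
    then show ?thesis by blast
  next
    case (Cons x xs')
    then show ?thesis using tail.prems by auto
  qed
  then show ?case using tail.IH by auto
qed

lemma geodesic_pos_neg:
  assumes "geodesic (pos xs @ neg ys)"
  shows "normal xs ys"
proof -
  have w: "pos xs @ neg ys \<in> words" using assms by (simp add: geodesic_def)
  have "irreducible (pos xs @ neg ys)"
    using step_pos_neg[OF _ HOL.refl] step_weq[OF _ w] assms
    unfolding irreducible_def geodesic_def by (meson leD)
  then show ?thesis using irreducible_pos_neg_iff[OF w] by blast
qed

end

text \<open>
  Exchanging the signs of all letters, without reversing the word, turns the relations of \<open>T\<close> into
  those of its dual.  So everything known about words with the positive letters first also holds
  for words with the negative letters first.
\<close>

definition triella_dual :: "('p \<times> 'p \<times> 'p) set \<Rightarrow> ('p \<times> 'p \<times> 'p) set" where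
  "triella_dual T = {(z, y, x) | x y z. (x, y, z) \<in> T}"

lemma triella_dual_iff [simp]: "(x, y, z) \<in> triella_dual T \<longleftrightarrow> (z, y, x) \<in> T"
  by (auto simp: triella_dual_def)

context triella_system
begin

text \<open>Duality exchanges \<open>ex_line\<close> with \<open>ex_meet\<close>, while
  \<open>line_unique\<close> is self-dual: its two alternatives trade places.\<close>

lemma triella_system_dual: "triella_system P (triella_dual T)"
proof
  show "triella_dual T \<subseteq> P \<times> P \<times> P" using T_sub by (auto simp: triella_dual_def)
  show "(y, z, x) \<in> triella_dual T" if "(x, y, z) \<in> triella_dual T" for x y z
    using that T_rot by simp
  show "z = z'" if "(x, y, z) \<in> triella_dual T" "(x, y, z') \<in> triella_dual T" for x y z z'
    using that T_fun1 by simp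
  show "\<exists>s u v. (s, x, u) \<in> triella_dual T \<and> (s, y, v) \<in> triella_dual T"
    if "x \<in> P" "y \<in> P" "x \<noteq> y" for x y
    using ex_meet[OF that] T_rot by simp blast
  show "\<exists>s u v. (x, s, u) \<in> triella_dual T \<and> (y, s, v) \<in> triella_dual T"
    if "x \<in> P" "y \<in> P" "x \<noteq> y" for x y
    using ex_line[OF that] T_rot by simp blast
  show "x = y \<or> s = t"
    if "(s, x, z1) \<in> triella_dual T" "(s, y, z2) \<in> triella_dual T"
      "(t, x, z3) \<in> triella_dual T" "(t, y, z4) \<in> triella_dual T" for s t x y z1 z2 z3 z4
    using that line_unique[of x s z1 t z3 y z2 z4] T_rot by simp blast
qed

definition flip :: "('p \<times> bool) list \<Rightarrow> ('p \<times> bool) list" where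
  "flip w = map (\<lambda>(x, b). (x, \<not> b)) w"

lemma flip_simps [simp]: "flip [] = []" "flip (v @ w) = flip v @ flip w"
  "flip (pos xs) = neg xs" "flip (neg xs) = pos xs" "flip ((x, b) # w) = (x, \<not> b) # flip w"
  "length (flip w) = length w"
  by (simp_all add: flip_def)

lemma flip_words: "w \<in> words \<Longrightarrow> flip w \<in> words"
  by (auto simp: flip_def)

lemma weq_flip: "weq v w \<Longrightarrow> pres_eq P (triella_relators (triella_dual T)) (flip v) (flip w)"
proof (induction rule: pres_eq.induct)
  case (refl w)
  then show ?case using pres_eq.refl flip_words words_iff by metis
next
  case (sym v w)
  then show ?case by (blast intro: pres_eq.sym)
next
  case (trans u v w)
  then show ?case by (blast intro: pres_eq.trans)
next
  case (append u v u' v')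
  then show ?case by (simp add: pres_eq.append)
next
  case (cancel x b)
  then show ?case using pres_eq.cancel[of x P _ "\<not> b"] by simp
next
  case (relator r)
  interpret D: triella_system P "triella_dual T" by (rule triella_system_dual)
  obtain x y z where r: "r = [(x, True), (y, True), (z, True)]" "(x, y, z) \<in> T"
    using relator unfolding triella_relators_def by auto
  have x: "x \<in> P" using r T_P by blast
  \<comment> \<open>In the dual, \<open>(z, y, x)\<close> is a triple, so the last two letters of
    the flipped relator multiply to \<open>a\<^sub>x\<close>, which cancels the first.\<close>
  have "D.weq ([(x, False)] @ [(y, False), (z, False)]) ([(x, False)] @ [(x, True)])"
    using D.weq_append_left[OF D.weq_triangle(2)[of z y x], of "[(x, False)]"] r x by simp
  then show ?case using D.weq_cancel[OF x, of False] r by (auto intro: pres_eq.trans)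
qed

definition antinormal :: "'p list \<Rightarrow> 'p list \<Rightarrow> bool" where
  "antinormal = triella_system.normal P (triella_dual T)"

text \<open>The dual incidence is \<open>inc\<close> with its arguments exchanged, so the condition
  inside each block is the original one. Only the junction condition links the two blocks, which
  allows blocks of different words to be combined.\<close>

lemma antinormal_iff:
  "antinormal xs ys \<longleftrightarrow> normal [] xs \<and> normal ys [] \<and> (xs \<noteq> [] \<and> ys \<noteq> [] \<longrightarrow> last xs \<noteq> hd ys)"
proof -
  interpret D: triella_system P "triella_dual T" by (rule triella_system_dual)
  have "D.inc x y \<longleftrightarrow> inc y x" for x y
    unfolding D.inc_def inc_def using T_rot by simp blast
  then show ?thesis by (auto simp: antinormal_def normal_def D.normal_def)
qed

lemma geodesic_middle: "geodesic (u @ v @ w) \<Longrightarrow> geodesic v"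
  using geodesic_append by blast

lemma geodesic_two_letters: "geodesic [(x, b), (y, \<not> b)] \<Longrightarrow> x \<noteq> y"
  using weq_cancel[of x b] unfolding geodesic_def by fastforce

text \<open>Forwards, both blocks are geodesic as subwords and the letters at the junction must not
  cancel. Backwards, \<open>flip\<close> carries equal words to words equal in the dual and keeps
  lengths, so minimality is inherited from the dual normal form.\<close>

lemma geodesic_neg_pos_iff: "geodesic (neg xs @ pos ys) \<longleftrightarrow> antinormal xs ys"
proof
  assume g: "geodesic (neg xs @ pos ys)"
  have "last xs \<noteq> hd ys" if n: "xs \<noteq> []" "ys \<noteq> []"
  proof -
    obtain xs' x where x: "xs = xs' @ [x]" using n by (cases xs rule: rev_cases) auto
    obtain y ys' where y: "ys = y # ys'" using n by (cases ys) auto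
    have "geodesic (neg xs' @ [(x, False), (y, True)] @ pos ys')" using g x y by simp
    from geodesic_middle[OF this] have "geodesic [(x, False), (y, \<not> False)]" by simp
    then show ?thesis using geodesic_two_letters[of x False y] x y by simp
  qed
  moreover have "normal [] xs" "normal ys []"
    using geodesic_pos_neg[of "[]" xs] geodesic_pos_neg[of ys "[]"] geodesic_append[OF g] by simp_all
  ultimately show "antinormal xs ys" by (simp add: antinormal_iff)
next
  assume a: "antinormal xs ys"
  interpret D: triella_system P "triella_dual T" by (rule triella_system_dual)
  have "D.geodesic (flip (neg xs @ pos ys))"
    using D.normal_geodesic a by (simp add: antinormal_def)
  moreover have "neg xs @ pos ys \<in> words" using a by (auto simp: antinormal_iff normal_def)
  ultimately show "geodesic (neg xs @ pos ys)"
    using weq_flip[of "neg xs @ pos ys"] unfolding geodesic_def D.geodesic_def by fastforce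
qed

lemma antinormal_unique:
  assumes "antinormal xs ys" "antinormal xs' ys'" "weq (neg xs @ pos ys) (neg xs' @ pos ys')"
  shows "xs = xs' \<and> ys = ys'"
proof -
  interpret D: triella_system P "triella_dual T" by (rule triella_system_dual)
  show ?thesis using D.normal_unique weq_flip[OF assms(3)] assms(1,2) by (simp add: antinormal_def)
qed

section \<open>Exchanging positive and negative blocks of geodesic words\<close>

lemma geodesic_replace:
  assumes "geodesic (u @ v @ w)" "weq v v'" "length v' = length v"
  shows "geodesic (u @ v' @ w)" "weq (u @ v @ w) (u @ v' @ w)"
proof -
  have "u \<in> words" "w \<in> words" using assms(1) by (auto simp: geodesic_def)
  then show e: "weq (u @ v @ w) (u @ v' @ w)"
    using weq_append_left weq_append_right assms(2) by blast
  show "geodesic (u @ v' @ w)" by (rule geodesic_weq[OF assms(1) e]) (simp add: assms(3))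
qed

lemma geodesic_neg_pos_swap:
  assumes "geodesic (neg ys @ pos xs)"
  obtains us vs where "normal us vs" "weq (neg ys @ pos xs) (pos us @ neg vs)"
    "length us = length xs" "length vs = length ys"
  by (rule geodesic_normal_form[OF assms], rule that) simp_all

text \<open>This is \<open>swap\<close> read backwards. Its middle point \<open>s\<close> is the
  intersection of the lines of \<open>x\<close> and \<open>y\<close>, supplied by
  \<open>ex_meet\<close>.\<close>

lemma pos_neg_swap_one:
  assumes "x \<in> P" "y \<in> P" "x \<noteq> y"
  obtains u v where "weq [(x, True), (y, False)] [(u, False), (v, True)]"
proof -
  obtain s u v where s: "(x, s, u) \<in> T" "(y, s, v) \<in> T" using ex_meet assms by blast
  have "u \<noteq> v" using s assms(3) T_fun1 by blast
  then have "rule (u, False) (v, True) [(x, True), (y, False)]"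
    using swap[of u x s v y] s T_rot by blast
  then show ?thesis using that rule_weq pres_eq.sym by blast
qed

text \<open>The negative letter travels left through the positive block. Each exchange keeps the
  word geodesic, so the next two letters to be exchanged are again distinct.\<close>

lemma pos_neg_swap_row:
  "geodesic (pos xs @ [(y, False)]) \<Longrightarrow>
    \<exists>v us. length us = length xs \<and> weq (pos xs @ [(y, False)]) ((v, False) # pos us)"
proof (induction xs arbitrary: y rule: rev_induct)
  case Nil
  then show ?case by (intro exI[of _ y] exI[of _ "[]"]) (simp add: geodesic_def weq_refl)
next
  case (snoc x xs)
  have g: "geodesic (pos xs @ [(x, True), (y, \<not> True)] @ [])" using snoc.prems by simp
  have xy: "x \<in> P" "y \<in> P" using g by (auto simp: geodesic_def)
  obtain v u where e: "weq [(x, True), (y, \<not> True)] [(v, False), (u, True)]"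
    using pos_neg_swap_one[OF xy] geodesic_two_letters[OF geodesic_middle[OF g]] by auto
  note r = geodesic_replace[OF g e]
  have "geodesic ((pos xs @ [(v, False)]) @ [(u, True)])" using r(1) by simp
  note g' = geodesic_append[OF this]
  obtain v' us where IH: "length us = length xs" "weq (pos xs @ [(v, False)]) ((v', False) # pos us)"
    using snoc.IH[OF g'(1)] by blast
  have "weq ((pos xs @ [(v, False)]) @ [(u, True)]) (((v', False) # pos us) @ [(u, True)])"
    using weq_append_right[OF IH(2)] g'(2) by (simp add: geodesic_def)
  then have "weq (pos (xs @ [x]) @ [(y, False)]) ((v', False) # pos (us @ [u]))"
    using r(2) pres_eq.trans by fastforce
  then show ?case using IH(1) by (intro exI[of _ v'] exI[of _ "us @ [u]"]) simp
qed

lemma geodesic_pos_neg_swap: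
  "geodesic (pos xs @ neg ys) \<Longrightarrow>
    \<exists>vs us. length us = length xs \<and> length vs = length ys \<and> weq (pos xs @ neg ys) (neg vs @ pos us)"
proof (induction ys arbitrary: xs)
  case Nil
  then show ?case by (intro exI[of _ "[]"] exI[of _ xs]) (simp add: geodesic_def weq_refl)
next
  case (Cons y ys)
  have g: "geodesic ([] @ (pos xs @ [(y, False)]) @ neg ys)" using Cons.prems by simp
  obtain v us where e: "length us = length xs" "weq (pos xs @ [(y, False)]) ((v, False) # pos us)"
    using pos_neg_swap_row[OF geodesic_middle[OF g]] by blast
  note r = geodesic_replace[OF g e(2)]
  have "geodesic ([(v, False)] @ (pos us @ neg ys))" using r(1) e(1) by simp
  note g' = geodesic_append[OF this]
  obtain vs us' where IH: "length us' = length us" "length vs = length ys"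
    "weq (pos us @ neg ys) (neg vs @ pos us')" using Cons.IH[OF g'(2)] by blast
  have "weq ([(v, False)] @ (pos us @ neg ys)) ([(v, False)] @ (neg vs @ pos us'))"
    using weq_append_left[OF IH(3), of "[(v, False)]"] g'(1) by (simp add: geodesic_def)
  then have "weq (pos xs @ neg (y # ys)) (neg (v # vs) @ pos us')"
    using r(2) e(1) pres_eq.trans by fastforce
  then show ?case using IH e by (intro exI[of _ "v # vs"] exI[of _ us']) simp
qed

text \<open>
  The middle part \<open>M\<close> is geodesic by duality, say with normal form \<open>as bs\<inverse>\<close>.  By uniqueness of normal
  forms, the first letter of \<open>as\<close> already appears when \<open>q\<close> alone is moved to the left, and the last
  letter of \<open>bs\<close> when \<open>p\<close> alone is moved to the right; so the two hypotheses control the junctions of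
  \<open>as\<close> with \<open>xs\<close> and of \<open>bs\<close> with \<open>ys\<close>.
\<close>

lemma geodesic_glue_normal:
  assumes l: "geodesic (pos xs @ neg ns @ [(p, False), (q, True)])"
    and r: "geodesic ([(p, False), (q, True)] @ pos ks @ neg ys)"
  shows "geodesic (pos xs @ neg ns @ [(p, False), (q, True)] @ pos ks @ neg ys)"
proof -
  let ?M = "neg (ns @ [p]) @ pos (q # ks)"
  have l1: "geodesic (pos xs @ (neg (ns @ [p]) @ pos [q]) @ [])" using l by simp
  have r1: "geodesic ([] @ (neg [p] @ pos (q # ks)) @ neg ys)" using r by simp
  have l2: "antinormal (ns @ [p]) [q]" using geodesic_middle[OF l1] geodesic_neg_pos_iff by blast
  have r2: "antinormal [p] (q # ks)" using geodesic_middle[OF r1] geodesic_neg_pos_iff by blast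
  \<comment> \<open>\<open>l2\<close> supplies the negative block and the junction
    \<open>p \<noteq> q\<close>, and \<open>r2\<close> supplies the positive block.\<close>
  have M: "geodesic ?M"
    using l2 r2 unfolding geodesic_neg_pos_iff antinormal_iff by simp
  obtain as bs where ab: "normal as bs" "weq ?M (pos as @ neg bs)"
    "length as = length (q # ks)" "length bs = length (ns @ [p])"
    using geodesic_neg_pos_swap[OF M] by blast
  obtain as1 bs1 where left: "normal as1 bs1" "weq (neg (ns @ [p]) @ pos [q]) (pos as1 @ neg bs1)"
    "length as1 = length [q]" "length bs1 = length (ns @ [p])"
    using geodesic_neg_pos_swap[OF geodesic_middle[OF l1]] by blast
  obtain a where a: "as1 = [a]" using left(3) by (cases as1) auto
  have "geodesic (pos (xs @ [a]) @ neg bs1)"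
    using geodesic_replace(1)[OF l1 left(2)] left(3,4) a by simp
  then have Xa: "normal (xs @ [a]) bs1" by (rule geodesic_pos_neg)
  have M1: "geodesic ([] @ (neg (ns @ [p]) @ pos [q]) @ pos ks)" using M by simp
  note t1 = geodesic_replace[OF M1 left(2)]
  have M2: "geodesic (pos [a] @ (neg bs1 @ pos ks) @ [])" using t1(1) left(3,4) a by simp
  obtain as2 bs2 where s2: "weq (neg bs1 @ pos ks) (pos as2 @ neg bs2)"
    "length as2 = length ks" "length bs2 = length bs1"
    using geodesic_neg_pos_swap[OF geodesic_middle[OF M2]] by metis
  note t2 = geodesic_replace[OF M2 s2(1)]
  have "normal (a # as2) bs2" using geodesic_pos_neg[of "a # as2" bs2] t2(1) s2 by simp
  moreover have "weq ?M (pos (a # as2) @ neg bs2)"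
    using t1(2) t2(2) left(3,4) s2 a pres_eq.trans by fastforce
  then have "weq (pos as @ neg bs) (pos (a # as2) @ neg bs2)"
    using ab(2) pres_eq.trans pres_eq.sym by blast
  ultimately have as: "as = a # as2" using normal_unique ab(1) by blast
  obtain as3 bs3 where right: "normal as3 bs3" "weq (neg [p] @ pos (q # ks)) (pos as3 @ neg bs3)"
    "length as3 = length (q # ks)" "length bs3 = length [p]"
    using geodesic_neg_pos_swap[OF geodesic_middle[OF r1]] by blast
  obtain b where b: "bs3 = [b]" using right(4) by (cases bs3) auto
  have "geodesic (pos as3 @ neg (b # ys))"
    using geodesic_replace(1)[OF r1 right(2)] right(3,4) b by simp
  then have bY: "normal as3 (b # ys)" by (rule geodesic_pos_neg)
  have M3: "geodesic (neg ns @ (neg [p] @ pos (q # ks)) @ [])" using M by simp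
  note t3 = geodesic_replace[OF M3 right(2)]
  have M4: "geodesic ([] @ (neg ns @ pos as3) @ neg [b])" using t3(1) right(3,4) b by simp
  obtain as4 bs4 where s4: "weq (neg ns @ pos as3) (pos as4 @ neg bs4)"
    "length as4 = length as3" "length bs4 = length ns"
    using geodesic_neg_pos_swap[OF geodesic_middle[OF M4]] by metis
  note t4 = geodesic_replace[OF M4 s4(1)]
  have "normal as4 (bs4 @ [b])" using geodesic_pos_neg[of as4 "bs4 @ [b]"] t4(1) s4 by simp
  moreover have "weq ?M (pos as4 @ neg (bs4 @ [b]))"
    using t3(2) t4(2) right(3,4) s4 b pres_eq.trans by fastforce
  then have "weq (pos as @ neg bs) (pos as4 @ neg (bs4 @ [b]))"
    using ab(2) pres_eq.trans pres_eq.sym by blast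
  ultimately have bs: "bs = bs4 @ [b]" using normal_unique ab(1) by blast
  \<comment> \<open>The list \<open>bs4\<close> may be empty. In either case appending
    \<open>ys\<close> leaves the first letter of \<open>bs\<close> in place, so the junction of
    \<open>as\<close> with \<open>bs\<close> stays admissible.\<close>
  have "hd (bs4 @ b # ys) = hd (bs4 @ [b])" by (cases bs4) auto
  then have "normal (xs @ as) (bs @ ys)"
    using Xa bY ab(1) unfolding as bs normal_def by (auto simp: successively_append_iff)
  then have "geodesic (pos xs @ (pos as @ neg bs) @ neg ys)" using normal_geodesic by fastforce
  from geodesic_replace(1)[OF this pres_eq.sym[OF ab(2)]] show ?thesis using ab(3,4) by simp
qed

text \<open>This is what makes the composition of the 2-graph additive in shape. Normal forms of
  \<open>c\<close> and \<open>b\<close>, and a word for \<open>u\<close> with one negative letter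
  before one positive letter, reduce the claim to \<open>geodesic_glue_normal\<close> without
  changing any length.\<close>

lemma geodesic_glue:
  assumes l: "geodesic (c @ u)" and r: "geodesic (u @ b)" and u: "weight u = (1, 1)"
  shows "geodesic (c @ u @ b)"
proof -
  obtain xs ns where c: "weq c (pos xs @ neg ns)" "weight c = (length xs, length ns)"
    using geodesic_normal_form[OF geodesic_append(1)[OF l]] by metis
  obtain ks ys where b: "weq b (pos ks @ neg ys)" "weight b = (length ks, length ys)"
    using geodesic_normal_form[OF geodesic_append(2)[OF r]] by metis
  obtain us vs where uv: "normal us vs" "weq u (pos us @ neg vs)" "weight u = (length us, length vs)"
    using geodesic_normal_form[OF geodesic_append(2)[OF l]] by metis
  obtain us' vs' where e: "length us' = length us" "length vs' = length vs"
      "weq (pos us @ neg vs) (neg vs' @ pos us')"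
    using geodesic_pos_neg_swap[OF normal_geodesic[OF uv(1)]] by blast
  obtain p where p: "vs' = [p]" using e(2) uv(3) u by (cases vs' rule: list.exhaust; cases "tl vs'") auto
  obtain q where q: "us' = [q]" using e(1) uv(3) u by (cases us' rule: list.exhaust; cases "tl us'") auto
  have u': "weq u [(p, False), (q, True)]" using pres_eq.trans[OF uv(2) e(3)] p q by simp
  have len: "length c = length (pos xs @ neg ns)" "length b = length (pos ks @ neg ys)"
    "length u = length [(p, False), (q, True)]"
    using c(2) b(2) u by (simp_all add: length_weight)
  have "geodesic (pos xs @ neg ns @ [(p, False), (q, True)])"
    using geodesic_weq[OF l pres_eq.append[OF c(1) u']] len by simp
  moreover have "geodesic ([(p, False), (q, True)] @ pos ks @ neg ys)"
    using geodesic_weq[OF r pres_eq.append[OF u' b(1)]] len by simp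
  ultimately have "geodesic (pos xs @ neg ns @ [(p, False), (q, True)] @ pos ks @ neg ys)"
    by (rule geodesic_glue_normal)
  moreover have "weq (pos xs @ neg ns @ [(p, False), (q, True)] @ pos ks @ neg ys) (c @ u @ b)"
    using pres_eq.sym[OF pres_eq.append[OF c(1) pres_eq.append[OF u' b(1)]]] by simp
  ultimately show ?thesis by (rule geodesic_weq) (simp add: len)
qed

section \<open>The shape function on the group\<close>

abbreviation G :: "('p \<times> bool) list set monoid" where
  "G \<equiv> A2_group P T"

abbreviation cls :: "('p \<times> bool) list \<Rightarrow> ('p \<times> bool) list set" where
  "cls \<equiv> pres_class P (triella_relators T)"

lemma group_G: "group G"
  unfolding A2_group_def by (rule group_presented_group)

sublocale group G by (rule group_G)

lemma carrier_G: "carrier G = cls ` words"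
  unfolding A2_group_def presented_group_def using words_iff by auto

lemma cls_carrier [simp]: "w \<in> words \<Longrightarrow> cls w \<in> carrier G"
  by (simp add: carrier_G)

lemma cls_eq_iff: "w \<in> words \<Longrightarrow> cls v = cls w \<longleftrightarrow> weq v w"
  using pres_class_eqI[of P "triella_relators T" v w] weq_refl unfolding pres_class_def by blast

lemma cls_mult: "v \<in> words \<Longrightarrow> w \<in> words \<Longrightarrow> cls v \<otimes>\<^bsub>G\<^esub> cls w = cls (v @ w)"
  unfolding A2_group_def using presented_group_mult words_iff by metis

lemma one_G: "\<one>\<^bsub>G\<^esub> = cls []"
  by (simp add: A2_group_def presented_group_def)

text \<open>Any geodesic word may represent the element, so words with negative letters first can be
  used directly. Agreement with \<open>A2_shape\<close> is shown in
  \<open>A2_shape_eq\<close>.\<close>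

definition shape :: "('p \<times> bool) list set \<Rightarrow> nat \<times> nat" where
  "shape g = (THE mn. \<exists>w. geodesic w \<and> g = cls w \<and> mn = weight w)"

lemma geodesic_words: "geodesic w \<Longrightarrow> w \<in> words"
  by (simp add: geodesic_def)

section \<open>Additivity of shapes and unique factorisation\<close>

lemma geodesic_weight_eq:
  assumes "geodesic v" "geodesic w" "weq v w"
  shows "weight v = weight w"
proof -
  obtain xs ys where v: "normal xs ys" "weq v (pos xs @ neg ys)" "weight v = (length xs, length ys)"
    using geodesic_normal_form[OF assms(1)] by blast
  obtain xs' ys' where w: "normal xs' ys'" "weq w (pos xs' @ neg ys')"
    "weight w = (length xs', length ys')" using geodesic_normal_form[OF assms(2)] by blast
  have "weq (pos xs @ neg ys) (pos xs' @ neg ys')"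
    using assms(3) v(2) w(2) by (blast intro: pres_eq.trans pres_eq.sym)
  then show ?thesis using normal_unique v w by metis
qed

lemma shape_cls [simp]: "geodesic w \<Longrightarrow> shape (cls w) = weight w"
  unfolding shape_def
  by (rule the_equality) (auto simp: geodesic_words cls_eq_iff dest: geodesic_weight_eq pres_eq.sym)

lemma carrier_normal:
  assumes "g \<in> carrier G"
  obtains xs ys where "normal xs ys" "g = cls (pos xs @ neg ys)" "shape g = (length xs, length ys)"
proof -
  obtain w where w: "w \<in> words" "g = cls w" using assms by (auto simp: carrier_G)
  obtain xs ys where n: "normal xs ys" "steps w (pos xs @ neg ys)" using normal_form_exists w by blast
  have "g = cls (pos xs @ neg ys)"
    using w n steps_weq normal_words cls_eq_iff by blast
  then show ?thesis using that n normal_geodesic[OF n(1)] by simp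
qed

lemma carrier_geodesic:
  assumes "g \<in> carrier G"
  obtains w where "geodesic w" "g = cls w"
  using carrier_normal[OF assms] normal_geodesic by metis

text \<open>Length is the sum of the two components of the weight. If the shapes add up, then
  \<open>v @ w\<close> is no longer than a geodesic word for the product.\<close>

lemma geodesic_append_iff:
  assumes "geodesic v" "geodesic w"
  shows "geodesic (v @ w) \<longleftrightarrow> shape (cls v \<otimes>\<^bsub>G\<^esub> cls w) = shape (cls v) + shape (cls w)"
proof -
  have vw: "v \<in> words" "w \<in> words" using assms geodesic_words by blast+
  have e: "cls v \<otimes>\<^bsub>G\<^esub> cls w = cls (v @ w)" using vw cls_mult by blast
  show ?thesis
  proof
    assume a: "shape (cls v \<otimes>\<^bsub>G\<^esub> cls w) = shape (cls v) + shape (cls w)"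
    have "cls (v @ w) \<in> carrier G" using vw by simp
    then obtain t where t: "geodesic t" "cls (v @ w) = cls t" by (rule carrier_geodesic)
    then have "weight t = weight (v @ w)" using a assms e by simp
    then have "length (v @ w) \<le> length t" by (simp only: length_weight)
    moreover have "weq t (v @ w)" using t geodesic_words cls_eq_iff pres_eq.sym by blast
    ultimately show "geodesic (v @ w)" using geodesic_weq t(1) by blast
  qed (simp add: assms e)
qed

lemma shape_one [simp]: "shape \<one>\<^bsub>G\<^esub> = 0"
  using shape_cls[of "[]"] by (simp add: one_G geodesic_def)

lemma shape_factor_exists:
  assumes "g \<in> carrier G" "shape g = m + n"
  obtains h k where "h \<in> carrier G" "k \<in> carrier G" "g = h \<otimes>\<^bsub>G\<^esub> k" "shape h = m" "shape k = n"
proof -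
  obtain xs ys where g: "normal xs ys" "g = cls (pos xs @ neg ys)" "shape g = (length xs, length ys)"
    using assms(1) by (rule carrier_normal)
  obtain m1 m2 n1 n2 where mn: "m = (m1, m2)" "n = (n1, n2)" by (cases m; cases n)
  \<comment> \<open>The first factor is to receive \<open>m1\<close> positive and \<open>m2\<close>
    negative letters. Exchanging the middle blocks \<open>xs2\<close> and \<open>ys1\<close> then
    brings its letters together at the front.\<close>
  define xs1 xs2 ys1 ys2 where d: "xs1 = take m1 xs" "xs2 = drop m1 xs" "ys1 = take m2 ys" "ys2 = drop m2 ys"
  have s: "xs = xs1 @ xs2" "ys = ys1 @ ys2" by (simp_all add: d)
  have len: "length xs1 = m1" "length xs2 = n1" "length ys1 = m2" "length ys2 = n2"
    using g(3) assms(2) mn by (auto simp: d)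
  have g1: "geodesic (pos xs1 @ (pos xs2 @ neg ys1) @ neg ys2)"
    using normal_geodesic[OF g(1)] s by simp
  obtain vs us where e: "length us = length xs2" "length vs = length ys1"
      "weq (pos xs2 @ neg ys1) (neg vs @ pos us)"
    using geodesic_pos_neg_swap[OF geodesic_middle[OF g1]] by blast
  note r = geodesic_replace[OF g1 e(3)]
  have gg: "geodesic ((pos xs1 @ neg vs) @ (pos us @ neg ys2))" using r(1) e by simp
  note g2 = geodesic_append[OF gg]
  note w = g2[THEN geodesic_words]
  have "weq (pos xs @ neg ys) ((pos xs1 @ neg vs) @ (pos us @ neg ys2))" using r(2) e s by simp
  then have "g = cls (pos xs1 @ neg vs) \<otimes>\<^bsub>G\<^esub> cls (pos us @ neg ys2)"
    using g(2) cls_mult[OF w] cls_eq_iff[OF geodesic_words[OF gg]] by simp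
  moreover have "shape (cls (pos xs1 @ neg vs)) = m" "shape (cls (pos us @ neg ys2)) = n"
    using g2 len e mn by simp_all
  ultimately show ?thesis using that w[THEN cls_carrier] by blast
qed

text \<open>Exchanging the middle blocks puts both products into normal form. Uniqueness there, with
  the prescribed lengths, identifies the outer blocks and the exchanged middle; uniqueness of
  antinormal forms then identifies the original middle blocks.\<close>

lemma shape_factor_unique:
  assumes c: "h \<in> carrier G" "k \<in> carrier G" "h' \<in> carrier G" "k' \<in> carrier G"
    and e: "h \<otimes>\<^bsub>G\<^esub> k = h' \<otimes>\<^bsub>G\<^esub> k'" "shape h = shape h'" "shape k = shape k'"
      "shape (h \<otimes>\<^bsub>G\<^esub> k) = shape h + shape k"
  shows "h = h' \<and> k = k'"
proof -
  obtain xs ns where h: "normal xs ns" "h = cls (pos xs @ neg ns)" "shape h = (length xs, length ns)"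
    using c(1) by (rule carrier_normal)
  obtain ks ys where k: "normal ks ys" "k = cls (pos ks @ neg ys)" "shape k = (length ks, length ys)"
    using c(2) by (rule carrier_normal)
  obtain xs' ns' where h': "normal xs' ns'" "h' = cls (pos xs' @ neg ns')" "shape h' = (length xs', length ns')"
    using c(3) by (rule carrier_normal)
  obtain ks' ys' where k': "normal ks' ys'" "k' = cls (pos ks' @ neg ys')" "shape k' = (length ks', length ys')"
    using c(4) by (rule carrier_normal)
  note ng = normal_geodesic[OF h(1)] normal_geodesic[OF k(1)]
    normal_geodesic[OF h'(1)] normal_geodesic[OF k'(1)]
  note nw = ng[THEN geodesic_words]
  let ?w = "(pos xs @ neg ns) @ (pos ks @ neg ys)" and ?w' = "(pos xs' @ neg ns') @ (pos ks' @ neg ys')"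
  have g: "geodesic ?w" "geodesic ?w'"
    using e h(2) k(2) h'(2) k'(2) geodesic_append_iff ng by metis+
  have ww: "weq ?w ?w'"
    using e(1) cls_eq_iff[OF geodesic_words[OF g(2)], of ?w] cls_mult[OF nw(1,2)] cls_mult[OF nw(3,4)]
    unfolding h(2) k(2) h'(2) k'(2) by metis
  have g1: "geodesic (pos xs @ (neg ns @ pos ks) @ neg ys)"
    "geodesic (pos xs' @ (neg ns' @ pos ks') @ neg ys')" using g by simp_all
  obtain us vs where s: "weq (neg ns @ pos ks) (pos us @ neg vs)"
    "length us = length ks" "length vs = length ns"
    using geodesic_neg_pos_swap[OF geodesic_middle[OF g1(1)]] by metis
  obtain us' vs' where s': "weq (neg ns' @ pos ks') (pos us' @ neg vs')"
    "length us' = length ks'" "length vs' = length ns'"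
    using geodesic_neg_pos_swap[OF geodesic_middle[OF g1(2)]] by metis
  note r = geodesic_replace[OF g1(1) s(1)] and r' = geodesic_replace[OF g1(2) s'(1)]
  have n: "normal (xs @ us) (vs @ ys)" "normal (xs' @ us') (vs' @ ys')"
    using geodesic_pos_neg[of "xs @ us" "vs @ ys"] geodesic_pos_neg[of "xs' @ us'" "vs' @ ys'"] r(1) r'(1) s s'
    by simp_all
  have "weq ?w (pos (xs @ us) @ neg (vs @ ys))" "weq ?w' (pos (xs' @ us') @ neg (vs' @ ys'))"
    using r(2) r'(2) s s' by simp_all
  then have "weq (pos (xs @ us) @ neg (vs @ ys)) (pos (xs' @ us') @ neg (vs' @ ys'))"
    using ww by (blast intro: pres_eq.trans pres_eq.sym)
  from normal_unique[OF n this]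
  have eqs: "xs = xs'" "us = us'" "vs = vs'" "ys = ys'"
    using e(2,3) h(3) h'(3) k(3) k'(3) s s' by auto
  have "weq (neg ns @ pos ks) (neg ns' @ pos ks')"
    using s(1) s'(1) eqs by (blast intro: pres_eq.trans pres_eq.sym)
  then have "ns = ns' \<and> ks = ks'"
    using antinormal_unique geodesic_middle[OF g1(1)] geodesic_middle[OF g1(2)] geodesic_neg_pos_iff
    by blast
  then show ?thesis using eqs h(2) k(2) h'(2) k'(2) by simp
qed

text \<open>Additivity makes the concatenation of three geodesic words geodesic, and subwords of a
  geodesic word are geodesic.\<close>

lemma shape_mult3:
  assumes c: "h \<in> carrier G" "k \<in> carrier G" "l \<in> carrier G"
    and e: "shape (h \<otimes>\<^bsub>G\<^esub> k \<otimes>\<^bsub>G\<^esub> l) = shape h + shape k + shape l"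
  shows "shape (h \<otimes>\<^bsub>G\<^esub> k) = shape h + shape k" "shape (k \<otimes>\<^bsub>G\<^esub> l) = shape k + shape l"
proof -
  obtain u v w where u: "geodesic u" "h = cls u" and v: "geodesic v" "k = cls v"
    and w: "geodesic w" "l = cls w"
    using carrier_geodesic c by metis
  note uw = u(1)[THEN geodesic_words] v(1)[THEN geodesic_words] w(1)[THEN geodesic_words]
  have x: "h \<otimes>\<^bsub>G\<^esub> k \<otimes>\<^bsub>G\<^esub> l = cls (u @ v @ w)" using uw u v w by (simp add: cls_mult)
  then obtain t where t: "geodesic t" "cls (u @ v @ w) = cls t"
    using carrier_geodesic[of "cls (u @ v @ w)"] uw by auto
  have "weight t = weight (u @ v @ w)" using t u v w e x by (simp add: add.assoc)
  then have "length (u @ v @ w) \<le> length t" by (simp only: length_weight)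
  moreover have "weq t (u @ v @ w)" using t geodesic_words cls_eq_iff pres_eq.sym by blast
  ultimately have g: "geodesic (u @ v @ w)" using geodesic_weq t(1) by blast
  then have "geodesic (u @ v)" "geodesic (v @ w)" using geodesic_append[of "u @ v" w] geodesic_append[of u "v @ w"] by simp_all
  then show "shape (h \<otimes>\<^bsub>G\<^esub> k) = shape h + shape k" "shape (k \<otimes>\<^bsub>G\<^esub> l) = shape k + shape l"
    using geodesic_append_iff u v w by simp_all
qed

lemma shape_glue:
  assumes c: "h \<in> carrier G" "u \<in> carrier G" "k \<in> carrier G" and u: "shape u = (1, 1)"
    and e: "shape (h \<otimes>\<^bsub>G\<^esub> u) = shape h + (1, 1)" "shape (u \<otimes>\<^bsub>G\<^esub> k) = (1, 1) + shape k"
  shows "shape (h \<otimes>\<^bsub>G\<^esub> u \<otimes>\<^bsub>G\<^esub> k) = shape h + (1, 1) + shape k"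
proof -
  obtain v1 v2 v3 where v: "geodesic v1" "h = cls v1" "geodesic v2" "u = cls v2" "geodesic v3" "k = cls v3"
    using carrier_geodesic c by metis
  note vw = v(1)[THEN geodesic_words] v(3)[THEN geodesic_words] v(5)[THEN geodesic_words]
  have "weight v2 = (1, 1)" using u v by simp
  moreover have "geodesic (v1 @ v2)" "geodesic (v2 @ v3)"
    using e u v geodesic_append_iff by simp_all
  ultimately have "geodesic (v1 @ v2 @ v3)" by (intro geodesic_glue)
  then show ?thesis using v vw u by (simp add: cls_mult add.assoc)
qed

end

section \<open>The 2-graph and its cocycle\<close>

locale triella_plane = triella_system P T
  for P :: "'p set" and T :: "('p \<times> 'p \<times> 'p) set" +
  fixes I :: "'p \<Rightarrow> 'l \<Rightarrow> bool" and lam :: "'p \<Rightarrow> 'l"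
  assumes incidence: "x \<in> P \<Longrightarrow> y \<in> P \<Longrightarrow> I y (lam x) \<longleftrightarrow> inc x y"
begin

section \<open>Agreement with the shape and the factorisation defined through lines\<close>

lemma A2_normal_iff: "A2_normal P I lam xs ys \<longleftrightarrow> normal xs ys"
proof -
  have "successively (\<lambda>x x'. \<not> I x' (lam x)) xs \<longleftrightarrow> successively (\<lambda>x x'. \<not> inc x x') xs"
    if "set xs \<subseteq> P" using that incidence by (intro successively_cong HOL.refl) blast
  moreover have "successively (\<lambda>y y'. \<not> I y (lam y')) ys \<longleftrightarrow> successively (\<lambda>y y'. \<not> inc y' y) ys"
    if "set ys \<subseteq> P" using that incidence by (intro successively_cong HOL.refl) blast
  ultimately show ?thesis unfolding A2_normal_def normal_def by blast
qed

lemma inv_gen: "x \<in> P \<Longrightarrow> inv\<^bsub>G\<^esub> cls [(x, True)] = cls [(x, False)]"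
  using pres_class_eqI[OF weq_cancel[of x False]]
  by (intro inv_equality) (auto simp: cls_mult one_G)

lemma foldr_letters: "w \<in> words \<Longrightarrow> foldr (mult G) (map (\<lambda>a. cls [a]) w) \<one>\<^bsub>G\<^esub> = cls w"
  by (induction w) (auto simp: one_G cls_mult)

lemma A2_product_eq:
  assumes "normal xs ys"
  shows "A2_product P T xs ys = cls (pos xs @ neg ys)"
proof -
  have P: "set ys \<subseteq> P" using assms by (simp add: normal_def)
  then have "map (\<lambda>y. inv\<^bsub>G\<^esub> cls [(y, True)]) ys = map (\<lambda>y. cls [(y, False)]) ys"
    using inv_gen by (intro map_cong HOL.refl) blast
  then have letters: "map (A2_gen P T) xs @ map (\<lambda>y. inv\<^bsub>G\<^esub> A2_gen P T y) ys =
      map (\<lambda>a. cls [a]) (pos xs @ neg ys)"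
    by (simp add: A2_gen_def)
  show ?thesis
    unfolding A2_product_def letters by (rule foldr_letters[OF normal_words[OF assms]])
qed

lemma A2_shape_eq:
  assumes "g \<in> carrier G"
  shows "A2_shape P I lam T g = shape g"
  unfolding A2_shape_def
proof (rule the_equality)
  obtain xs ys where "normal xs ys" "g = cls (pos xs @ neg ys)" "shape g = (length xs, length ys)"
    using assms by (rule carrier_normal)
  then show "\<exists>xs ys. A2_normal P I lam xs ys \<and> shape g = (length xs, length ys) \<and> g = A2_product P T xs ys"
    using A2_product_eq A2_normal_iff by metis
next
  fix mn assume "\<exists>xs ys. A2_normal P I lam xs ys \<and> mn = (length xs, length ys) \<and> g = A2_product P T xs ys"
  then show "mn = shape g" using A2_product_eq A2_normal_iff normal_geodesic by force
qed

lemma A2_factor_eq: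
  assumes "h \<in> carrier G" "k \<in> carrier G" "shape (h \<otimes>\<^bsub>G\<^esub> k) = shape h + shape k"
  shows "A2_factor P I lam T (shape h) (shape k) (h \<otimes>\<^bsub>G\<^esub> k) = (h, k)"
  unfolding A2_factor_def
proof (rule the_equality)
  fix hk assume a: "fst hk \<in> carrier G \<and> snd hk \<in> carrier G \<and> h \<otimes>\<^bsub>G\<^esub> k = fst hk \<otimes>\<^bsub>G\<^esub> snd hk \<and>
    A2_shape P I lam T (fst hk) = shape h \<and> A2_shape P I lam T (snd hk) = shape k"
  then have "shape h = shape (fst hk)" "shape k = shape (snd hk)"
    using A2_shape_eq[of "fst hk"] A2_shape_eq[of "snd hk"] by metis+
  then have "h = fst hk \<and> k = snd hk"
    using shape_factor_unique[of h k "fst hk" "snd hk"] assms a by blast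
  then show "hk = (h, k)" by simp
qed (use assms in \<open>simp add: A2_shape_eq\<close>)

abbreviation "\<Lambda> \<equiv> A2_graph P I lam T"
abbreviation "rr \<equiv> A2_r P I lam T"
abbreviation "bb \<equiv> A2_b P I lam T"
abbreviation "cc \<equiv> A2_c P I lam T"
abbreviation "ss \<equiv> A2_s P I lam T"

section \<open>Range, source and composition of arrows\<close>

lemma arrows_iff: "w \<in> arrows \<Lambda> \<longleftrightarrow> w \<in> carrier G \<and> (1, 1) \<le> shape w"
  by (auto simp: A2_graph_def A2_shape_eq)

lemma objects_iff: "w \<in> objects \<Lambda> \<longleftrightarrow> w \<in> carrier G \<and> shape w = (1, 1)"
  by (auto simp: A2_graph_def A2_shape_eq)

lemma graph_sel: "rng \<Lambda> = rr" "src \<Lambda> = ss" "cmp \<Lambda> v w = cc v \<otimes>\<^bsub>G\<^esub> ss v \<otimes>\<^bsub>G\<^esub> bb w"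
  by (simp_all add: A2_graph_def)

text \<open>By unique factorisation, \<open>rr\<close> and \<open>bb\<close> can be read off from
  any product with additive shapes whose first factor has shape \<open>(1, 1)\<close>.\<close>

lemma range_factor:
  assumes "u \<in> carrier G" "b \<in> carrier G" "shape u = (1, 1)" "shape (u \<otimes>\<^bsub>G\<^esub> b) = (1, 1) + shape b"
  shows "u \<otimes>\<^bsub>G\<^esub> b \<in> arrows \<Lambda>" "rr (u \<otimes>\<^bsub>G\<^esub> b) = u" "bb (u \<otimes>\<^bsub>G\<^esub> b) = b"
proof -
  have "A2_shape P I lam T (u \<otimes>\<^bsub>G\<^esub> b) - (1, 1) = shape b"
    using assms A2_shape_eq[of "u \<otimes>\<^bsub>G\<^esub> b"] by (cases "shape b") simp
  then show "rr (u \<otimes>\<^bsub>G\<^esub> b) = u" "bb (u \<otimes>\<^bsub>G\<^esub> b) = b"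
    using A2_factor_eq[of u b] assms by (simp_all add: A2_r_def A2_b_def)
  show "u \<otimes>\<^bsub>G\<^esub> b \<in> arrows \<Lambda>" using assms by (cases "shape b") (simp add: arrows_iff)
qed

lemma source_factor:
  assumes "u \<in> carrier G" "c \<in> carrier G" "shape u = (1, 1)" "shape (c \<otimes>\<^bsub>G\<^esub> u) = shape c + (1, 1)"
  shows "c \<otimes>\<^bsub>G\<^esub> u \<in> arrows \<Lambda>" "cc (c \<otimes>\<^bsub>G\<^esub> u) = c" "ss (c \<otimes>\<^bsub>G\<^esub> u) = u"
proof -
  have "A2_shape P I lam T (c \<otimes>\<^bsub>G\<^esub> u) - (1, 1) = shape c"
    using assms A2_shape_eq[of "c \<otimes>\<^bsub>G\<^esub> u"] by (cases "shape c") simp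
  then show "cc (c \<otimes>\<^bsub>G\<^esub> u) = c" "ss (c \<otimes>\<^bsub>G\<^esub> u) = u"
    using A2_factor_eq[of c u] assms by (simp_all add: A2_c_def A2_s_def)
  show "c \<otimes>\<^bsub>G\<^esub> u \<in> arrows \<Lambda>" using assms by (cases "shape c") (simp add: arrows_iff)
qed

lemma arrow_range:
  assumes "w \<in> arrows \<Lambda>"
  shows "rr w \<in> objects \<Lambda>" "bb w \<in> carrier G" "rr w \<otimes>\<^bsub>G\<^esub> bb w = w" "shape w = (1, 1) + shape (bb w)"
proof -
  \<comment> \<open>The truncated subtraction is exact because \<open>(1, 1) \<le> shape w\<close>
    for an arrow.\<close>
  have w: "w \<in> carrier G" "shape w = (1, 1) + (shape w - (1, 1))"
    using assms by (auto simp: arrows_iff prod_eq_iff less_eq_prod_def)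
  obtain u b where ub: "u \<in> carrier G" "b \<in> carrier G" "w = u \<otimes>\<^bsub>G\<^esub> b" "shape u = (1, 1)"
      "shape b = shape w - (1, 1)"
    using w by (rule shape_factor_exists)
  then have "shape w = (1, 1) + shape b" using w(2) by simp
  then show "rr w \<in> objects \<Lambda>" "bb w \<in> carrier G" "rr w \<otimes>\<^bsub>G\<^esub> bb w = w" "shape w = (1, 1) + shape (bb w)"
    using range_factor[of u b] ub by (simp_all add: objects_iff)
qed

lemma arrow_source:
  assumes "w \<in> arrows \<Lambda>"
  shows "ss w \<in> objects \<Lambda>" "cc w \<in> carrier G" "cc w \<otimes>\<^bsub>G\<^esub> ss w = w" "shape w = shape (cc w) + (1, 1)"
proof -
  have w: "w \<in> carrier G" "shape w = (shape w - (1, 1)) + (1, 1)"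
    using assms by (auto simp: arrows_iff prod_eq_iff less_eq_prod_def)
  obtain c u where cu: "c \<in> carrier G" "u \<in> carrier G" "w = c \<otimes>\<^bsub>G\<^esub> u"
      "shape c = shape w - (1, 1)" "shape u = (1, 1)"
    using w by (rule shape_factor_exists)
  then have "shape w = shape c + (1, 1)" using w(2) by simp
  then show "ss w \<in> objects \<Lambda>" "cc w \<in> carrier G" "cc w \<otimes>\<^bsub>G\<^esub> ss w = w" "shape w = shape (cc w) + (1, 1)"
    using source_factor[of u c] cu by (simp_all add: objects_iff)
qed

lemma object_arrow:
  assumes "u \<in> objects \<Lambda>"
  shows "u \<in> arrows \<Lambda>" "rr u = u" "ss u = u" "cc u = \<one>\<^bsub>G\<^esub>" "bb u = \<one>\<^bsub>G\<^esub>"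
  using range_factor[of u "\<one>\<^bsub>G\<^esub>"] source_factor[of u "\<one>\<^bsub>G\<^esub>"] assms by (simp_all add: objects_iff)

lemma arrow_carrier: "w \<in> arrows \<Lambda> \<Longrightarrow> w \<in> carrier G"
  by (simp add: arrows_iff)

lemma object_carrier: "u \<in> objects \<Lambda> \<Longrightarrow> u \<in> carrier G"
  by (simp add: objects_iff)

text \<open>The composite has two further expressions, \<open>rr v\<close> times \<open>bb v\<close>
  times \<open>bb w\<close>, and \<open>cc v\<close> times \<open>cc w\<close> times
  \<open>ss w\<close>. Both have additive shapes by \<open>shape_glue\<close>, so unique
  factorisation yields its range and source data.\<close>

lemma composite:
  assumes v: "v \<in> arrows \<Lambda>" and w: "w \<in> arrows \<Lambda>" and vw: "ss v = rr w"
  shows "cmp \<Lambda> v w \<in> arrows \<Lambda>" "rr (cmp \<Lambda> v w) = rr v" "ss (cmp \<Lambda> v w) = ss w"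
    "cc (cmp \<Lambda> v w) = cc v \<otimes>\<^bsub>G\<^esub> cc w" "bb (cmp \<Lambda> v w) = bb v \<otimes>\<^bsub>G\<^esub> bb w"
proof -
  note r = arrow_range[OF v] arrow_range[OF w] and s = arrow_source[OF v] arrow_source[OF w]
  note car = arrow_carrier[OF v] arrow_carrier[OF w] r(1,5)[THEN object_carrier] s(1,5)[THEN object_carrier]
    r(2,6) s(2,6)
  note u = r(1,5)[unfolded objects_iff, THEN conjunct2] s(1,5)[unfolded objects_iff, THEN conjunct2]
  let ?x = "cc v \<otimes>\<^bsub>G\<^esub> ss v \<otimes>\<^bsub>G\<^esub> bb w"
  have x: "cmp \<Lambda> v w = ?x" by (simp add: graph_sel)
  have shape_x: "shape ?x = shape (cc v) + (1, 1) + shape (bb w)"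
    using shape_glue[of "cc v" "ss v" "bb w"] car u r s vw by simp
  \<comment> \<open>Removing an object from either end of an arrow leaves the same shape; this
    matches the shapes of the three expressions.\<close>
  have bw: "shape (bb w) = shape (cc w)" using r(8) s(8) by (simp add: add.commute)
  have bv: "shape (bb v) = shape (cc v)" using r(4) s(4) by (simp add: add.commute)
  have x1: "?x = rr v \<otimes>\<^bsub>G\<^esub> bb v \<otimes>\<^bsub>G\<^esub> bb w" using r(3) s(3) by simp
  have x2: "?x = cc v \<otimes>\<^bsub>G\<^esub> (cc w \<otimes>\<^bsub>G\<^esub> ss w)" using r(7) s(7) vw car by (simp add: m_assoc)
  have "shape (rr v \<otimes>\<^bsub>G\<^esub> bb v \<otimes>\<^bsub>G\<^esub> bb w) = shape (rr v) + shape (bb v) + shape (bb w)"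
    using shape_x x1 u bv by (simp add: add.commute)
  note sh1 = this shape_mult3(2)[OF car(3,7,8) this]
  have "shape (cc v \<otimes>\<^bsub>G\<^esub> cc w \<otimes>\<^bsub>G\<^esub> ss w) = shape (cc v) + shape (cc w) + shape (ss w)"
    using shape_x x2 u bw car by (simp add: m_assoc ac_simps)
  note sh2 = this shape_mult3(1)[OF car(9,10,6) this]
  have y1: "?x = rr v \<otimes>\<^bsub>G\<^esub> (bb v \<otimes>\<^bsub>G\<^esub> bb w)" using x1 car by (simp add: m_assoc)
  have y2: "?x = (cc v \<otimes>\<^bsub>G\<^esub> cc w) \<otimes>\<^bsub>G\<^esub> ss w" using x2 car by (simp add: m_assoc)
  have f1: "shape (rr v \<otimes>\<^bsub>G\<^esub> (bb v \<otimes>\<^bsub>G\<^esub> bb w)) = (1, 1) + shape (bb v \<otimes>\<^bsub>G\<^esub> bb w)"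
    using sh1 u car by (simp add: m_assoc add.assoc)
  have f2: "shape (cc v \<otimes>\<^bsub>G\<^esub> cc w \<otimes>\<^bsub>G\<^esub> ss w) = shape (cc v \<otimes>\<^bsub>G\<^esub> cc w) + (1, 1)"
    using sh2 u by simp
  show "cmp \<Lambda> v w \<in> arrows \<Lambda>" "rr (cmp \<Lambda> v w) = rr v" "bb (cmp \<Lambda> v w) = bb v \<otimes>\<^bsub>G\<^esub> bb w"
    unfolding x y1 using range_factor[OF _ _ _ f1] car u by simp_all
  show "ss (cmp \<Lambda> v w) = ss w" "cc (cmp \<Lambda> v w) = cc v \<otimes>\<^bsub>G\<^esub> cc w"
    unfolding x y2 using source_factor[OF _ _ _ f2] car u by simp_all
qed

lemma small_category_graph: "small_category \<Lambda>"
  unfolding small_category_def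
proof (intro conjI ballI impI subsetI; (elim conjE)?)
  show "u \<in> arrows \<Lambda>" "rng \<Lambda> u = u" "src \<Lambda> u = u" if "u \<in> objects \<Lambda>" for u
    using object_arrow[OF that] by (simp_all add: graph_sel(1,2))
  fix a assume a: "a \<in> arrows \<Lambda>"
  note ra = arrow_range[OF a] and sa = arrow_source[OF a]
  show "rng \<Lambda> a \<in> objects \<Lambda>" "src \<Lambda> a \<in> objects \<Lambda>" using ra sa by (simp_all add: graph_sel(1,2))
  show "cmp \<Lambda> (rng \<Lambda> a) a = a"
    unfolding graph_sel using object_arrow[OF ra(1)] ra object_carrier by simp
  show "cmp \<Lambda> a (src \<Lambda> a) = a"
    unfolding graph_sel using object_arrow[OF sa(1)] sa arrow_carrier[OF a] by simp
  fix b assume b: "b \<in> arrows \<Lambda>"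
  { assume "src \<Lambda> a = rng \<Lambda> b"
    then show "cmp \<Lambda> a b \<in> arrows \<Lambda>" "rng \<Lambda> (cmp \<Lambda> a b) = rng \<Lambda> a" "src \<Lambda> (cmp \<Lambda> a b) = src \<Lambda> b"
      using composite[OF a b] by (simp_all add: graph_sel(1,2)) }
  note rb = arrow_range[OF b] and sb = arrow_source[OF b]
  fix c assume c: "c \<in> arrows \<Lambda>" and m: "src \<Lambda> a = rng \<Lambda> b" "src \<Lambda> b = rng \<Lambda> c"
  have m': "ss a = rr b" "ss b = rr c" using m by (simp_all add: graph_sel)
  note car = sa(2) sb(2) rb(2) arrow_range(2)[OF c] rb(1)[THEN object_carrier] sb(1)[THEN object_carrier]
  \<comment> \<open>Both bracketings are \<open>cc a\<close> times \<open>b\<close> times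
    \<open>bb c\<close>, with \<open>b\<close> split at its source on one side and at its range on
    the other.\<close>
  have "cmp \<Lambda> (cmp \<Lambda> a b) c = cc a \<otimes>\<^bsub>G\<^esub> (cc b \<otimes>\<^bsub>G\<^esub> ss b) \<otimes>\<^bsub>G\<^esub> bb c"
    using composite[OF a b m'(1)] car by (simp add: graph_sel(3) m_assoc)
  also have "\<dots> = cc a \<otimes>\<^bsub>G\<^esub> (rr b \<otimes>\<^bsub>G\<^esub> bb b) \<otimes>\<^bsub>G\<^esub> bb c"
    using rb(3) sb(3) by simp
  also have "\<dots> = cmp \<Lambda> a (cmp \<Lambda> b c)"
    using composite[OF b c m'(2)] car m' by (simp add: graph_sel(3) m_assoc)
  finally show "cmp \<Lambda> (cmp \<Lambda> a b) c = cmp \<Lambda> a (cmp \<Lambda> b c)" .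
qed

lemma essential_cocycle_c: "essential_cocycle \<Lambda> G cc"
  unfolding essential_cocycle_def one_cocycle_def
proof (intro conjI ballI impI inj_onI)
  show "cc (cmp \<Lambda> a b) = cc a \<otimes>\<^bsub>G\<^esub> cc b"
    if "a \<in> arrows \<Lambda>" "b \<in> arrows \<Lambda>" "src \<Lambda> a = rng \<Lambda> b" for a b
    using composite(4)[OF that(1,2)] that(3) by (simp add: graph_sel(1,2))
  show "x = y" if "x \<in> {a \<in> arrows \<Lambda>. rng \<Lambda> a = u \<and> src \<Lambda> a = v}"
      "y \<in> {a \<in> arrows \<Lambda>. rng \<Lambda> a = u \<and> src \<Lambda> a = v}" "cc x = cc y" for u v x y
    using that arrow_source(3)[of x] arrow_source(3)[of y] by (simp add: graph_sel(1,2))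
qed (use arrow_source(2) object_arrow(4) in simp_all)

end

section \<open>The pair groupoid times a group as test groupoid, and injectivity of
  \<open>i\<close>\<close>

definition transitive_groupoid :: "'a set \<Rightarrow> ('g, 'm) monoid_scheme \<Rightarrow> ('a \<times> 'g \<times> 'a) category" where
  "transitive_groupoid U G =
     \<lparr> arrows = U \<times> carrier G \<times> U, objects = (\<lambda>u. (u, \<one>\<^bsub>G\<^esub>, u)) ` U,
       rng = (\<lambda>(u, g, v). (u, \<one>\<^bsub>G\<^esub>, u)), src = (\<lambda>(u, g, v). (v, \<one>\<^bsub>G\<^esub>, v)),
       cmp = (\<lambda>(u, g, v) (u', h, v'). (u, g \<otimes>\<^bsub>G\<^esub> h, v')) \<rparr>"

lemma groupoid_transitive_groupoid:
  assumes "group G"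
  shows "groupoid (transitive_groupoid U G)"
proof -
  interpret group G by fact
  have "\<exists>b\<in>arrows (transitive_groupoid U G). rng (transitive_groupoid U G) b = src (transitive_groupoid U G) a \<and>
      src (transitive_groupoid U G) b = rng (transitive_groupoid U G) a \<and>
      cmp (transitive_groupoid U G) a b = rng (transitive_groupoid U G) a \<and>
      cmp (transitive_groupoid U G) b a = src (transitive_groupoid U G) a"
    if "a \<in> arrows (transitive_groupoid U G)" for a
  proof -
    obtain u g v where "a = (u, g, v)" by (cases a)
    then show ?thesis using that
      by (intro bexI[of _ "(v, inv\<^bsub>G\<^esub> g, u)"]) (auto simp: transitive_groupoid_def)
  qed
  moreover have "small_category (transitive_groupoid U G)"
    unfolding small_category_def transitive_groupoid_def by (auto simp: m_assoc)
  ultimately show ?thesis unfolding groupoid_def by blast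
qed

lemma essential_cocycle_imp_inj_on:
  fixes C :: "('a, 'm) category_scheme" and Q :: "'q category"
  assumes C: "small_category C" and G: "group G" and c: "essential_cocycle C G c"
    and Q: "fundamental_groupoid C Q i"
  shows "inj_on i (arrows C)"
proof -
  let ?D = "transitive_groupoid (objects C) G" and ?F = "\<lambda>a. (rng C a, c a, src C a)"
  have cc: "one_cocycle C G c" using c by (simp add: essential_cocycle_def)
  have "is_functor C ?D ?F"
    using C cc unfolding is_functor_def transitive_groupoid_def one_cocycle_def small_category_def by auto
  \<comment> \<open>The arrows of this test groupoid have another type than the one fixed in
    \<open>fundamental_groupoid\<close>, so the universal property is taken from
    \<open>fundamental_groupoid_universal\<close>.\<close>
  then obtain H where H: "\<forall>a\<in>arrows C. H (i a) = ?F a"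
    by (rule fundamental_groupoid_wrtE[OF fundamental_groupoid_universal[OF C Q] groupoid_transitive_groupoid[OF G]])
  show ?thesis
  proof (rule inj_onI)
    fix a b assume ab: "a \<in> arrows C" "b \<in> arrows C" "i a = i b"
    then have "?F a = ?F b" using H by metis
    moreover have inj: "inj_on c {x \<in> arrows C. rng C x = rng C a \<and> src C x = src C a}"
      using c cat_ends[OF C ab(1)] unfolding essential_cocycle_def by blast
    ultimately show "a = b" using inj_onD[OF inj, of a b] ab(1,2) by simp
  qed
qed

text \<open>Surjectivity of \<open>lam\<close> names the line joining two points as
  \<open>lam s\<close>, which gives \<open>ex_line\<close>. Injectivity keeps the lines of distinct
  points distinct: they then have a common point, which gives \<open>ex_meet\<close>, and only one,
  which gives \<open>line_unique\<close>.\<close>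

lemma triella_plane_of_projective_plane:
  assumes plane: "finite_projective_plane q P L I" and lam: "bij_betw lam P L" and T: "triella P I lam T"
  shows "triella_plane P T I lam"
proof -
  have sub: "T \<subseteq> P \<times> P \<times> P" and rot: "\<And>x y z. (x, y, z) \<in> T \<Longrightarrow> (y, z, x) \<in> T"
    and incid: "\<And>x y. x \<in> P \<Longrightarrow> y \<in> P \<Longrightarrow> I y (lam x) \<longleftrightarrow> (\<exists>z. (x, y, z) \<in> T)"
    and func: "\<And>x y z z'. (x, y, z) \<in> T \<Longrightarrow> (x, y, z') \<in> T \<Longrightarrow> z = z'"
    using T unfolding triella_def by blast+
  have line: "\<forall>x\<in>P. \<forall>y\<in>P. x \<noteq> y \<longrightarrow> (\<exists>!l. l \<in> L \<and> I x l \<and> I y l)"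
    and meet: "\<forall>l\<in>L. \<forall>m\<in>L. l \<noteq> m \<longrightarrow> (\<exists>!x. x \<in> P \<and> I x l \<and> I x m)"
    using plane unfolding finite_projective_plane_def by - (elim conjE, assumption)+
  have L: "x \<in> P \<Longrightarrow> lam x \<in> L" for x using lam bij_betwE by blast
  have surj: "l \<in> L \<Longrightarrow> \<exists>x\<in>P. l = lam x" for l using bij_betw_imp_surj_on[OF lam] by blast
  have inj: "x \<in> P \<Longrightarrow> y \<in> P \<Longrightarrow> lam x = lam y \<Longrightarrow> x = y" for x y
    using bij_betw_imp_inj_on[OF lam] by (rule inj_onD)
  interpret triella_system P T
  proof
    show "\<exists>s u v. (s, x, u) \<in> T \<and> (s, y, v) \<in> T" if xy: "x \<in> P" "y \<in> P" "x \<noteq> y" for x y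
    proof -
      obtain l where "l \<in> L" "I x l" "I y l" using line xy by blast
      then obtain s where "s \<in> P" "I x (lam s)" "I y (lam s)" using surj by blast
      then show ?thesis using incid xy by blast
    qed
    show "\<exists>s u v. (x, s, u) \<in> T \<and> (y, s, v) \<in> T" if xy: "x \<in> P" "y \<in> P" "x \<noteq> y" for x y
    proof -
      have "lam x \<noteq> lam y" using inj xy by blast
      then obtain s where "s \<in> P" "I s (lam x)" "I s (lam y)" using meet L xy by blast
      then show ?thesis using incid xy by blast
    qed
    show "x = y \<or> s = t"
      if t: "(s, x, z1) \<in> T" "(s, y, z2) \<in> T" "(t, x, z3) \<in> T" "(t, y, z4) \<in> T"
      for s t x y z1 z2 z3 z4
    proof (rule disjCI)
      assume st: "s \<noteq> t"
      have p: "x \<in> P" "y \<in> P" "s \<in> P" "t \<in> P" using t sub by blast+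
      then have "lam s \<noteq> lam t" using inj st by blast
      moreover have "I x (lam s)" "I x (lam t)" "I y (lam s)" "I y (lam t)" using incid p t by blast+
      ultimately show "x = y" using meet L p by blast
    qed
  qed (use sub rot func in blast)+
  show ?thesis
    by unfold_locales (simp add: incid inc_def)
qed

theorem corollary5p19:
  fixes q :: nat and P :: "'p set" and L :: "'l set" and I :: "'p \<Rightarrow> 'l \<Rightarrow> bool"
    and lam :: "'p \<Rightarrow> 'l" and T :: "('p \<times> 'p \<times> 'p) set"
  assumes "finite_projective_plane q P L I"
    and "bij_betw lam P L"
    and "triella P I lam T"
  shows "essential_cocycle (A2_graph P I lam T) (A2_group P T) (A2_c P I lam T) \<and>
    (\<forall>(Q :: 'g category) i. fundamental_groupoid (A2_graph P I lam T) Q i \<longrightarrow>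
       inj_on i (arrows (A2_graph P I lam T)))"
proof -
  interpret triella_plane P T I lam by (rule triella_plane_of_projective_plane[OF assms])
  show ?thesis
    using essential_cocycle_c essential_cocycle_imp_inj_on[OF small_category_graph group_G essential_cocycle_c]
    by blast
qed

end
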